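(* Let $\theta>1$ be a real number, let $m$ be an integer with $m>\theta-1$, and let $f\in\mathbb{R}^n\setminus\{0\}$. Let $\Lambda\subset\mathbb{R}^n$ be a nonempty uniformly discrete set such that $$\Lambda\supseteq\theta\Lambda+\{0,1,\dots,m\}\cdot f .$$ Then $\theta$ is a Pisot number.
   Context: A set $\Lambda\subset\mathbb{R}^n$ is uniformly discrete if $\inf\{|x-y| : x,y\in\Lambda,\ x\ne y\}>0$. Notation: $\theta\Lambda=\{\theta x : x\in\Lambda\}$, $A+B=\{a+b : a\in A,\ b\in B\}$, and $\{0,1,\dots,m\}\cdot f=\{0,f,2f,\dots,mf\}$. A Pisot number is a real algebraic integer $\theta>1$ such that all other roots $\theta'\neq\theta$ of its minimal polynomial satisfy $|\theta'|<1$. *)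

theory Defs
  imports
    "HOL-Analysis.Analysis"
    "HOL-Library.Set_Algebras"
    "HOL-Computational_Algebra.Computational_Algebra"
begin

definition is_min_poly :: "'a :: field_char_0 \<Rightarrow> rat poly \<Rightarrow> bool" where
  "is_min_poly x p \<longleftrightarrow>
     lead_coeff p = 1 \<and> poly (map_poly of_rat p) x = 0 \<and>
     (\<forall>q. q \<noteq> 0 \<and> poly (map_poly of_rat q) x = 0 \<longrightarrow> degree p \<le> degree q)"

lemma poly_map_of_rat_diff:
  "poly (map_poly of_rat (p - q)) (x :: 'a :: field_char_0) =
   poly (map_poly of_rat p) x - poly (map_poly of_rat q) x"
proof -
  have "map_poly of_rat (p - q) = (map_poly of_rat p - map_poly of_rat q :: 'a poly)"
    by (intro poly_eqI) (simp add: coeff_map_poly of_rat_diff)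
  thus ?thesis by simp
qed

lemma is_min_poly_unique:
  assumes "is_min_poly x p" "is_min_poly x q"
  shows "p = q"
proof (rule ccontr)
  assume ne: "p \<noteq> q"
  have pq0: "p \<noteq> 0" "q \<noteq> 0"
    using assms by (auto simp: is_min_poly_def)
  have deg: "degree p = degree q"
  proof (rule antisym)
    show "degree p \<le> degree q" "degree q \<le> degree p"
      using assms pq0 unfolding is_min_poly_def by blast+
  qed
  have "poly (map_poly of_rat (p - q)) x = 0"
    using assms by (simp add: is_min_poly_def poly_map_of_rat_diff)
  with assms(1) ne have ge: "degree p \<le> degree (p - q)"
    unfolding is_min_poly_def by simp
  have "degree (p - q) \<le> degree p"
    using deg by (simp add: degree_diff_le)
  with ge have "degree (p - q) = degree p" by simp
  moreover have "coeff (p - q) (degree p) = 0"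
    using assms deg by (simp add: is_min_poly_def)
  ultimately have "lead_coeff (p - q) = 0" by simp
  hence "p - q = 0" by (simp only: leading_coeff_0_iff)
  with ne show False by simp
qed

text \<open>The roots other than \<open>\<theta>\<close> range over all complex roots of the minimal polynomial.\<close>

definition pisot :: "real \<Rightarrow> bool" where
  "pisot \<theta> \<longleftrightarrow>
     \<theta> > 1 \<and> algebraic_int \<theta> \<and>
     (\<exists>p. is_min_poly \<theta> p \<and>
          (\<forall>z :: complex. poly (map_poly of_rat p) z = 0 \<and> z \<noteq> complex_of_real \<theta> \<longrightarrow> cmod z < 1))"

text \<open>
  The library's \<^const>\<open>uniform_discrete\<close> says that the infimum of the distances between
  distinct points is positive, with infimum \<open>\<infinity>\<close> if there are no two distinct points.
\<close>

lemma uniform_discrete_iff_INF: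
  "uniform_discrete S \<longleftrightarrow>
     0 < (INF (x, y)\<in>{(x, y). x \<in> S \<and> y \<in> S \<and> x \<noteq> y}. ereal (dist x y))"
  (is "_ \<longleftrightarrow> 0 < ?I")
proof
  assume "uniform_discrete S"
  then obtain e where e: "e > 0" "\<And>x y. x \<in> S \<Longrightarrow> y \<in> S \<Longrightarrow> dist x y < e \<Longrightarrow> x = y"
    unfolding uniform_discrete_def by blast
  have "ereal e \<le> ?I"
    by (rule INF_greatest) (use e(2) in \<open>auto simp: not_less[symmetric]\<close>)
  thus "0 < ?I"
    using e(1) by (intro less_le_trans[of 0 "ereal e" ?I]) simp_all
next
  assume "0 < ?I"
  then obtain e where e: "0 < ereal e" "ereal e < ?I"
    using ereal_dense2 by blast
  show "uniform_discrete S"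
  proof (rule uniformI2)
    show "e > 0" using e(1) by simp
    fix x y assume "x \<in> S" "y \<in> S" "x \<noteq> y"
    hence "?I \<le> ereal (dist x y)"
      by (intro INF_lower2[of "(x, y)"]) auto
    with e(2) have "ereal e < ereal (dist x y)"
      by (rule less_le_trans)
    thus "dist x y \<ge> e" by simp
  qed
qed

end

theory Submission
  imports Defs
begin

text \<open>
  Write \<open>q\<close> for \<open>\<theta>\<close>. Iterating the inclusion from a point of \<open>\<Lambda>\<close> shows that the numbers
  \<open>\<Sum>i<k. a\<^sub>i * q ^ i\<close> with digits \<open>a\<^sub>i \<in> {0..m}\<close> are separated: distinct ones differ by at least
  some \<open>\<delta> > 0\<close> that does not depend on \<open>k\<close>. As \<open>m > q - 1\<close>, they are also dense at scale \<open>1\<close> in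
  \<open>[0, L * (q ^ k - 1)]\<close>, where \<open>L = m / (q - 1) > 1\<close>. The tension between these two facts makes
  \<open>q\<close> a Pisot number.

  The main tool is a window of length \<open>1\<close> that contains the largest possible number of values. If one
  prepends a string \<open>t\<close> to the strings in it, the translated window is full, too; so any string that
  lands there has the value of a string that begins with \<open>t\<close> (\<open>exists_synchronizing\<close>). This has two
  consequences. First, a difference of two strings that lies in \<open>[0, 1]\<close> is, up to a power of \<open>q\<close>,
  a difference of strings of a fixed length (\<open>differences_at_fixed_level\<close>). For the difference \<open>1\<close>
  this is a monic integer equation for \<open>q\<close>. Secondly, differences can be added by gluing strings in such
  windows, as long as the partial sums correspond to positions in the interval \<open>(0, L)\<close>. For a
  difference \<open>d > 0\<close> with \<open>d + 1/q < L\<close>, the steps \<open>d\<close> and \<open>-1/q\<close> can always be arranged in this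
  way, and hence every \<open>a * d - b / q\<close> in \<open>(-L, L)\<close> with natural numbers \<open>a\<close> and \<open>b\<close> equals
  \<open>\<Sum>0<i\<le>k. \<epsilon>\<^sub>i * q ^ (-i)\<close> for some \<open>k\<close> and digits \<open>\<epsilon>\<^sub>i \<in> {-m..m}\<close>
  (\<open>combination_is_difference\<close>).

  Now let \<open>p \<noteq> q\<close> be a conjugate of \<open>q\<close> with \<open>norm p \<ge> 1\<close>, and let \<open>d\<close> be as above,
  \<open>d = r(q)\<close> with a difference \<open>r\<close> of digit strings, read as polynomials. The claim is that \<open>p * r(p) = q * r(q)\<close>. If \<open>norm p > 1\<close>, the conjugate
  \<open>a * r(p) - b / p\<close> is bounded by a geometric series, while \<open>b\<close> may be taken to be the integer part of
  \<open>a * q * r(q)\<close>; let \<open>a\<close> tend to infinity (\<open>conjugate_outside\<close>). If \<open>norm p = 1\<close>, the conjugate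
  \<open>1/p\<close> of \<open>p\<close> forces the minimal polynomial to be reciprocal. Then \<open>1/q\<close> is a conjugate, and
  under \<open>q \<mapsto> 1/q\<close> the above sums turn into differences of strings in base \<open>q\<close> again, read
  backwards, of size \<open>O(a)\<close>. The conjugates of these differences have modulus \<open>norm (a * p * r(p) - b)\<close> and are \<open>O(log a)\<close>,
  since differences in \<open>[0, 1]\<close> have bounded conjugates. That is enough to let \<open>a\<close> tend to infinity
  (\<open>conjugate_on_unit_circle\<close>).

  Finally, take for \<open>d\<close> the first remainder below \<open>L - 1/q\<close> in the expansion of \<open>1\<close> with constant
  digit \<open>m\<close>. The quotient of \<open>z * r(z) - q * r(q)\<close> by \<open>z - q\<close> has as its coefficients the
  remainders up to \<open>d\<close>, which are positive and decreasing. By the theorem of Enestroem and Kakeya,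
  its roots have modulus less than \<open>1\<close>; but \<open>p\<close> is one of them.
\<close>

section \<open>Integer polynomials and digit strings\<close>

definition ipoly :: "int poly \<Rightarrow> 'a :: comm_ring_1 \<Rightarrow> 'a" where
  "ipoly f x = poly (map_poly of_int f) x"

lemma ipoly_eq_sum:
  assumes "\<And>i. i \<ge> n \<Longrightarrow> coeff f i = 0"
  shows "ipoly f x = (\<Sum>i<n. of_int (coeff f i) * x ^ i)"
proof -
  have eq: "map_poly of_int f = (\<Sum>i<n. monom (of_int (coeff f i)) i)"
    by (rule poly_eqI) (use assms in \<open>auto simp: coeff_map_poly coeff_sum not_less\<close>)
  show ?thesis
    unfolding ipoly_def eq by (simp add: poly_sum poly_monom)
qed

lemma ipoly_0 [simp]: "ipoly 0 x = 0"
  by (simp add: ipoly_def)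

lemma ipoly_1 [simp]: "ipoly 1 x = 1"
  by (simp add: ipoly_def)

lemma ipoly_monom [simp]: "ipoly (monom a n) x = of_int a * x ^ n"
  by (simp add: ipoly_def map_poly_monom poly_monom)

lemma ipoly_const [simp]: "ipoly [:a:] x = of_int a"
  using ipoly_monom[of a 0 x] by (simp add: monom_0)

lemma ipoly_add [simp]: "ipoly (f + g) x = ipoly f x + ipoly g x"
proof -
  have "map_poly of_int (f + g) = (map_poly of_int f + map_poly of_int g :: 'a poly)"
    by (intro poly_eqI) (simp add: coeff_map_poly)
  thus ?thesis by (simp add: ipoly_def)
qed

lemma ipoly_diff [simp]: "ipoly (f - g) x = ipoly f x - ipoly g x"
  using ipoly_add[of "f - g" g x] by simp

lemma ipoly_sum [simp]: "ipoly (sum f A) x = (\<Sum>i\<in>A. ipoly (f i) x)"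
  by (induction A rule: infinite_finite_induct) simp_all

lemma ipoly_smult [simp]: "ipoly (smult a f) x = of_int a * ipoly f x"
proof -
  have "map_poly of_int (smult a f) = smult (of_int a) (map_poly of_int f :: 'a poly)"
    by (intro poly_eqI) (simp add: coeff_map_poly)
  thus ?thesis by (simp add: ipoly_def)
qed

lemma ipoly_pCons [simp]: "ipoly (pCons a f) x = of_int a + x * ipoly f x"
  by (simp add: ipoly_def map_poly_pCons)

lemma ipoly_mult [simp]: "ipoly (f * g) x = ipoly f x * ipoly g x"
  by (induction f) (simp_all add: algebra_simps)

lemma ipoly_cnj: "ipoly f (cnj z) = cnj (ipoly f z)"
  by (induction f) simp_all

text \<open>
  A digit string is kept as a polynomial rather than as the number it represents, because the same
  string has to be read in base \<open>q\<close>, in base \<open>1/q\<close> and in the base of a conjugate of \<open>q\<close>.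
\<close>

definition digits :: "int \<Rightarrow> nat \<Rightarrow> int poly set" where
  "digits m k = {f. (\<forall>i. coeff f i \<in> {0..m}) \<and> (\<forall>i\<ge>k. coeff f i = 0)}"

lemma digits_append:
  assumes "x \<in> digits m n" "t \<in> digits m k"
  shows "monom 1 n * t + x \<in> digits m (n + k)"
  using assms by (auto simp: digits_def coeff_monom_mult)

lemma digits_split:
  assumes "f \<in> digits m (n + k)"
  obtains x t where "x \<in> digits m n" "t \<in> digits m k" "f = monom 1 n * t + x"
proof
  have "0 \<le> m" using assms by (force simp: digits_def)
  show "poly_cutoff n f \<in> digits m n" "poly_shift n f \<in> digits m k"
    using assms \<open>0 \<le> m\<close> by (auto simp: digits_def coeff_poly_cutoff coeff_poly_shift)
  show "f = monom 1 n * poly_shift n f + poly_cutoff n f"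
    by (rule poly_eqI) (simp add: coeff_monom_mult coeff_poly_cutoff coeff_poly_shift)
qed

lemma digits_mono:
  assumes "f \<in> digits m k" "k \<le> k'"
  shows "f \<in> digits m k'"
  using assms by (auto simp: digits_def)

lemma digits_0 [simp]: "digits m 0 \<subseteq> {0}"
  by (auto simp: digits_def poly_eq_iff)

lemma zero_in_digits: "0 \<le> m \<Longrightarrow> 0 \<in> digits m k"
  by (auto simp: digits_def)

lemma const_in_digits: "a \<in> {0..m} \<Longrightarrow> [:a:] \<in> digits m (Suc 0)"
  by (auto simp: digits_def coeff_pCons split: nat.splits)

lemma digits_top:
  assumes "x \<in> digits m n" "a \<in> {0..m}"
  shows "monom a n + x \<in> digits m (Suc n)"
proof -
  have "monom a n = monom 1 n * [:a:]"
    by (rule poly_eqI) (auto simp: coeff_monom_mult coeff_pCons split: nat.splits)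
  thus ?thesis
    using digits_append[OF assms(1) const_in_digits[OF assms(2)]] by simp
qed

lemma finite_digits: "finite (digits m k)"
proof (induction k)
  case 0
  show ?case by (rule finite_subset[OF digits_0]) simp
next
  case (Suc k)
  have "digits m (k + Suc 0) \<subseteq> (\<lambda>(x, t). monom 1 k * t + x) ` (digits m k \<times> (\<lambda>a. [:a:]) ` {0..m})"
  proof
    fix f assume "f \<in> digits m (k + Suc 0)"
    then obtain x t where xt: "x \<in> digits m k" "t \<in> digits m (Suc 0)" "f = monom 1 k * t + x"
      by (rule digits_split)
    have "t = [:coeff t 0:]"
      using xt(2) by (intro poly_eqI) (auto simp: digits_def coeff_pCons split: nat.splits)
    moreover have "coeff t 0 \<in> {0..m}" using xt(2) by (auto simp: digits_def)
    ultimately show "f \<in> (\<lambda>(x, t). monom 1 k * t + x) ` (digits m k \<times> (\<lambda>a. [:a:]) ` {0..m})"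
      using xt(1,3) by (force intro!: image_eqI[of _ _ "(x, t)"])
  qed
  moreover have "finite \<dots>" using Suc by simp
  ultimately show ?case by (auto intro: finite_subset)
qed

lemma norm_ipoly_digits_diff_le:
  fixes p :: complex
  assumes "f \<in> digits m k" "g \<in> digits m k"
  shows "norm (ipoly f p - ipoly g p) \<le> of_int m * (\<Sum>i<k. norm p ^ i)"
proof -
  have "ipoly f p - ipoly g p = ipoly (f - g) p" by simp
  also have "\<dots> = (\<Sum>i<k. of_int (coeff (f - g) i) * p ^ i)"
    by (rule ipoly_eq_sum) (use assms in \<open>auto simp: digits_def\<close>)
  also have "norm \<dots> \<le> (\<Sum>i<k. of_int m * norm p ^ i)"
  proof (rule sum_norm_le)
    fix i
    have "\<bar>coeff (f - g) i\<bar> \<le> m" 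
      using assms by (auto simp: digits_def abs_le_iff algebra_simps) (smt (verit))+
    hence "norm (of_int (coeff (f - g) i) :: complex) \<le> of_int m"
      by (metis norm_of_int of_int_abs of_int_le_iff)
    thus "norm (of_int (coeff (f - g) i) * p ^ i) \<le> of_int m * norm p ^ i"
      by (simp add: norm_mult norm_power mult_right_mono del: coeff_diff)
  qed
  finally show ?thesis by (simp add: sum_distrib_left)
qed

text \<open>
  Reading a string backwards exchanges the bases \<open>x\<close> and \<open>1/x\<close>, up to a power of \<open>x\<close>. This is
  how the conjugate \<open>1/q\<close> of \<open>q\<close> will be used when there are conjugates on the unit circle.
\<close>

definition reverse_digits :: "nat \<Rightarrow> int poly \<Rightarrow> int poly" where
  "reverse_digits j f = (\<Sum>i<j. monom (coeff f i) (j - Suc i))"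

lemma reverse_digits_in_digits:
  assumes "f \<in> digits m j"
  shows "reverse_digits j f \<in> digits m j"
proof -
  have "coeff (reverse_digits j f) i = (if i < j then coeff f (j - Suc i) else 0)" for i
  proof -
    have "coeff (reverse_digits j f) i = (\<Sum>l<j. if l = j - Suc i \<and> i < j then coeff f l else 0)"
      unfolding reverse_digits_def coeff_sum by (rule sum.cong) auto
    also have "\<dots> = (if i < j then coeff f (j - Suc i) else 0)"
      by (auto simp: sum.delta)
    finally show ?thesis .
  qed
  moreover have "0 \<le> m" using assms by (force simp: digits_def)
  ultimately show ?thesis using assms by (auto simp: digits_def)
qed

lemma ipoly_reverse_digits:
  fixes x :: "'a :: field"
  assumes "f \<in> digits m (Suc n)" "x \<noteq> 0"
  shows "ipoly (reverse_digits (Suc n) f) x = x ^ n * ipoly f (inverse x)"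
proof -
  have "ipoly (reverse_digits (Suc n) f) x = (\<Sum>i<Suc n. of_int (coeff f i) * x ^ (n - i))"
    by (simp add: reverse_digits_def)
  also have "\<dots> = (\<Sum>i<Suc n. x ^ n * (of_int (coeff f i) * inverse x ^ i))"
  proof (rule sum.cong)
    fix i assume "i \<in> {..<Suc n}"
    hence "x ^ n = x ^ (n - i) * x ^ i" by (simp flip: power_add)
    thus "of_int (coeff f i) * x ^ (n - i) = x ^ n * (of_int (coeff f i) * inverse x ^ i)"
      using assms(2) by (simp add: field_simps)
  qed simp
  also have "\<dots> = x ^ n * (\<Sum>i<Suc n. of_int (coeff f i) * inverse x ^ i)"
    by (simp only: sum_distrib_left)
  also have "(\<Sum>i<Suc n. of_int (coeff f i) * inverse x ^ i) = ipoly f (inverse x)"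
    by (rule ipoly_eq_sum[symmetric]) (use assms(1) in \<open>auto simp: digits_def\<close>)
  finally show ?thesis .
qed

section \<open>The values of digit strings in a separated base\<close>

locale separated_digits =
  fixes q \<delta> :: real and m :: int
  assumes q_gt_1: "q > 1" and m_gt: "of_int m > q - 1" and \<delta>_pos: "\<delta> > 0"
    and separated: "\<And>k f g. f \<in> digits m k \<Longrightarrow> g \<in> digits m k \<Longrightarrow> ipoly f q \<noteq> ipoly g q \<Longrightarrow>
                      \<delta> \<le> \<bar>ipoly f q - ipoly g q\<bar>"
begin

abbreviation val :: "int poly \<Rightarrow> real" where "val f \<equiv> ipoly f q"

text \<open>
  \<open>L\<close> is the length of the self-similar interval \<open>[0, L] = \<Union>a\<le>m. ([0, L] + a) / q\<close>. The
  values of strings of length \<open>k\<close>, divided by \<open>q ^ k\<close>, lie in this interval and become dense in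
  it as \<open>k\<close> grows. That \<open>L\<close> exceeds \<open>1\<close> is the overlap in this union, and all the room there is
  in the arguments below.
\<close>

definition L :: real where "L = of_int m / (q - 1)"

lemma q_nonzero [simp]: "q \<noteq> 0" using q_gt_1 by simp

lemma m_pos: "m > 0" using q_gt_1 m_gt by simp

lemma L_gt_1: "L > 1" using q_gt_1 m_gt by (simp add: L_def)

lemma L_mult_q: "q * L = L + of_int m"
  using q_gt_1 by (simp add: L_def field_simps)

definition maxval :: "nat \<Rightarrow> real" where "maxval k = L * (q ^ k - 1)"

lemma maxval_0 [simp]: "maxval 0 = 0" by (simp add: maxval_def)

lemma maxval_Suc: "maxval (Suc k) = of_int m * q ^ k + maxval k"
  using L_mult_q by (simp add: maxval_def algebra_simps) (metis distrib_right mult.assoc mult.commute)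

lemma maxval_ge: "q ^ k - 1 \<le> maxval k"
proof -
  have "1 * (q ^ k - 1) \<le> L * (q ^ k - 1)"
    using L_gt_1 q_gt_1 by (intro mult_right_mono) auto
  thus ?thesis by (simp add: maxval_def)
qed

lemma val_nonneg:
  assumes "f \<in> digits m k" shows "0 \<le> val f"
proof -
  have "val f = (\<Sum>i<k. of_int (coeff f i) * q ^ i)"
    by (rule ipoly_eq_sum) (use assms in \<open>auto simp: digits_def\<close>)
  also have "\<dots> \<ge> 0"
    using assms q_gt_1 by (intro sum_nonneg mult_nonneg_nonneg) (auto simp: digits_def)
  finally show ?thesis .
qed

lemma val_le_maxval:
  assumes "f \<in> digits m k" shows "val f \<le> maxval k"
proof -
  have "val f = (\<Sum>i<k. of_int (coeff f i) * q ^ i)"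
    by (rule ipoly_eq_sum) (use assms in \<open>auto simp: digits_def\<close>)
  also have "\<dots> \<le> (\<Sum>i<k. of_int m * q ^ i)"
    using assms q_gt_1 by (intro sum_mono mult_right_mono) (auto simp: digits_def)
  also have "\<dots> = maxval k"
    by (induction k) (simp_all add: maxval_Suc)
  finally show ?thesis .
qed

lemma exists_power_gt: "\<exists>k\<ge>K. B < q ^ k * c" if "c > 0" for c B :: real
proof -
  obtain k where k: "B / c < q ^ k"
    using real_arch_pow[OF q_gt_1] by blast
  also have "q ^ k \<le> q ^ max k K"
    using q_gt_1 by (intro power_increasing) auto
  finally have "B < q ^ max k K * c"
    using that by (simp add: field_simps)
  thus ?thesis by (intro exI[of _ "max k K"]) auto
qed

text \<open>
  The blocks with leading digits \<open>b\<close> and \<open>b + 1\<close> are \<open>q ^ n\<close> apart and each has length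
  \<open>maxval n \<ge> q ^ n - 1\<close>, so that no gap of length \<open>1\<close> opens between them.
\<close>

lemma dense_top_digit_step:
  assumes IH: "\<And>y. 0 \<le> y \<Longrightarrow> y \<le> maxval n \<Longrightarrow> \<exists>v\<in>digits m n. y \<le> val v \<and> val v < y + 1"
    and "0 \<le> y" "y \<le> of_nat B * q ^ n + maxval n"
  shows "\<exists>b\<le>B. \<exists>v\<in>digits m n. y \<le> of_nat b * q ^ n + val v \<and> of_nat b * q ^ n + val v < y + 1"
  using assms(3)
proof (induction B)
  case 0
  with IH[OF \<open>0 \<le> y\<close>] show ?case by auto
next
  case (Suc B)
  show ?case
  proof (cases "y \<le> of_nat B * q ^ n + maxval n")
    case True
    from Suc.IH[OF this] show ?thesis using le_Suc_eq by blast
  next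
    case False
    hence gt: "y > of_nat (Suc B) * q ^ n - 1"
      using maxval_ge[of n] by (simp add: algebra_simps)
    show ?thesis
    proof (cases "y \<ge> of_nat (Suc B) * q ^ n")
      case True
      hence "\<exists>v\<in>digits m n. y - of_nat (Suc B) * q ^ n \<le> val v \<and> val v < y - of_nat (Suc B) * q ^ n + 1"
        using Suc.prems by (intro IH) auto
      thus ?thesis by (intro exI[of _ "Suc B"]) (auto simp: algebra_simps)
    next
      case False
      thus ?thesis
        using gt m_pos by (intro exI[of _ "Suc B"] conjI bexI[of _ 0]) (auto simp: zero_in_digits)
    qed
  qed
qed

lemma digit_values_dense:
  assumes "0 \<le> y" "y \<le> maxval k"
  obtains v where "v \<in> digits m k" "y \<le> val v" "val v < y + 1"
proof -
  have "\<exists>v\<in>digits m k. y \<le> val v \<and> val v < y + 1"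
    using assms
  proof (induction k arbitrary: y)
    case 0
    thus ?case by (intro bexI[of _ 0]) (use m_pos in \<open>auto simp: zero_in_digits\<close>)
  next
    case (Suc k)
    have "y \<le> of_nat (nat m) * q ^ k + maxval k"
      using Suc.prems(2) m_pos by (simp add: maxval_Suc)
    from dense_top_digit_step[OF Suc.IH Suc.prems(1) this]
    obtain b v where bv: "b \<le> nat m" "v \<in> digits m k"
      "y \<le> of_nat b * q ^ k + val v" "of_nat b * q ^ k + val v < y + 1" by auto
    thus ?case
      using m_pos by (intro bexI[of _ "monom (int b) k + v"]) (auto intro!: digits_top)
  qed
  thus ?thesis using that by blast
qed

text \<open>
  Whenever \<open>y + q ^ n\<close> is still in range, \<open>y\<close> has an approximation whose leading digit can be
  increased. The corresponding statement for lower digits may fail when \<open>L\<close> is close to \<open>1\<close>.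
\<close>

lemma dense_below_top_digit:
  assumes "0 \<le> y" "y + q ^ n \<le> maxval (Suc n)"
  obtains b v where "0 \<le> b" "b < m" "v \<in> digits m n"
    "y \<le> of_int b * q ^ n + val v" "of_int b * q ^ n + val v < y + 1"
proof -
  have "y \<le> of_nat (nat (m - 1)) * q ^ n + maxval n"
    using assms(2) m_pos by (simp add: maxval_Suc algebra_simps)
  from dense_top_digit_step[OF _ assms(1) this]
  obtain b v where "b \<le> nat (m - 1)" "v \<in> digits m n"
    "y \<le> of_nat b * q ^ n + val v" "of_nat b * q ^ n + val v < y + 1"
    using digit_values_dense by metis
  thus ?thesis using that[of "int b" v] m_pos by auto
qed

section \<open>Synchronizing windows\<close>

lemma card_window_le:
  "card (val ` digits m k \<inter> {a..a+1}) \<le> card {0..\<lfloor>1 / \<delta>\<rfloor>}"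
proof (rule card_inj_on_le)
  show "inj_on (\<lambda>x. \<lfloor>(x - a) / \<delta>\<rfloor>) (val ` digits m k \<inter> {a..a+1})"
  proof (rule inj_onI, rule ccontr)
    fix x y assume x: "x \<in> val ` digits m k \<inter> {a..a+1}" and y: "y \<in> val ` digits m k \<inter> {a..a+1}"
      and eq: "\<lfloor>(x - a) / \<delta>\<rfloor> = \<lfloor>(y - a) / \<delta>\<rfloor>" and "x \<noteq> y"
    have "\<delta> \<le> \<bar>x - y\<bar>" using x y \<open>x \<noteq> y\<close> separated by blast
    moreover have "\<bar>(x - a) / \<delta> - (y - a) / \<delta>\<bar> < 1"
      using eq by linarith
    hence "\<bar>x - y\<bar> < \<delta>" using \<delta>_pos by (simp add: diff_divide_distrib[symmetric] abs_divide)
    ultimately show False by simp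
  qed
  show "(\<lambda>x. \<lfloor>(x - a) / \<delta>\<rfloor>) ` (val ` digits m k \<inter> {a..a+1}) \<subseteq> {0..\<lfloor>1 / \<delta>\<rfloor>}"
    using \<delta>_pos by (auto intro!: floor_mono divide_right_mono)
qed simp

text \<open>
  Whatever string lands in the window of length \<open>1\<close> at distance \<open>c\<close> above \<open>q ^ n * val t\<close>, its
  value is also obtained by appending \<open>n\<close> digits to \<open>t\<close>: a number in this window forgets every
  prefix but \<open>t\<close>. Statements about two different strings can therefore be glued together in such
  a window.
\<close>

definition synchronizing :: "nat \<Rightarrow> real \<Rightarrow> bool" where
  "synchronizing n c \<longleftrightarrow> 0 \<le> c \<and>
     (\<forall>k. \<forall>t\<in>digits m k. \<forall>g\<in>digits m (n + k).
        q ^ n * val t + c \<le> val g \<and> val g \<le> q ^ n * val t + c + 1 \<longrightarrow>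
        (\<exists>x\<in>digits m n. val g = q ^ n * val t + val x))"

text \<open>
  Separation bounds the number of values in a window of length \<open>1\<close>. Take a window where this
  number is largest. Prepending \<open>t\<close> to its members gives equally many members of the translated
  window, so there is no room for others.
\<close>

lemma exists_synchronizing: "\<exists>n c. synchronizing n c"
proof -
  define N where "N = (\<lambda>(n, c). card (val ` digits m n \<inter> {c..c+1}))"
  define P where "P = (\<lambda>(n :: nat, c :: real). 0 \<le> c)"
  have "\<exists>z. P z \<and> (\<forall>y. P y \<longrightarrow> N y \<le> N z)"
  proof (rule Lattices_Big.ex_has_greatest_nat)
    show "P (0, 0)" by (simp add: P_def)
    show "\<forall>y. P y \<longrightarrow> N y < Suc (card {0..\<lfloor>1 / \<delta>\<rfloor>})"
      using card_window_le by (auto simp: N_def less_Suc_eq_le simp del: card_atLeastAtMost_int)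
  qed
  then obtain n c where c: "0 \<le> c" and max: "\<And>n' c'. 0 \<le> c' \<Longrightarrow> N (n', c') \<le> N (n, c)"
    unfolding P_def by auto
  have "synchronizing n c"
    unfolding synchronizing_def
  proof (intro conjI allI ballI impI c)
    fix k t g assume t: "t \<in> digits m k" and g: "g \<in> digits m (n + k)"
      and bd: "q ^ n * val t + c \<le> val g \<and> val g \<le> q ^ n * val t + c + 1"
    define A where "A = (\<lambda>x. q ^ n * val t + x) ` (val ` digits m n \<inter> {c..c+1})"
    define B where "B = val ` digits m (n + k) \<inter> {q ^ n * val t + c..q ^ n * val t + c + 1}"
    have "A \<subseteq> B"
    proof
      fix y assume "y \<in> A"
      then obtain x where x: "x \<in> digits m n" "c \<le> val x" "val x \<le> c + 1" "y = q ^ n * val t + val x"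
        by (auto simp: A_def)
      have "y = val (monom 1 n * t + x)" using x(4) by simp
      thus "y \<in> B" using digits_append[OF x(1) t] x by (auto simp: B_def simp del: ipoly_add ipoly_mult)
    qed
    moreover have "finite B" by (simp add: B_def finite_digits)
    moreover have "card B \<le> card A"
    proof -
      have "card B = N (n + k, q ^ n * val t + c)" by (simp add: B_def N_def)
      also have "\<dots> \<le> N (n, c)" 
        using c val_nonneg[OF t] q_gt_1 by (intro max) auto
      also have "\<dots> = card A" unfolding A_def N_def by (simp add: card_image)
      finally show ?thesis .
    qed
    ultimately have "A = B" by (simp add: card_seteq)
    moreover have "val g \<in> B" using g bd by (auto simp: B_def)
    ultimately show "\<exists>x\<in>digits m n. val g = q ^ n * val t + val x"
      by (auto simp: A_def)
  qed
  thus ?thesis by blast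
qed

end

locale synchronized_digits = separated_digits +
  fixes n0 :: nat and c :: real
  assumes sync: "synchronizing n0 c"
begin

lemma c_nonneg: "0 \<le> c" using sync by (simp add: synchronizing_def)

lemma syncD:
  assumes "t \<in> digits m k" "g \<in> digits m (n0 + k)"
    "q ^ n0 * val t + c \<le> val g" "val g \<le> q ^ n0 * val t + c + 1"
  obtains x where "x \<in> digits m n0" "val g = q ^ n0 * val t + val x"
  using sync assms unfolding synchronizing_def by blast

text \<open>
  A difference \<open>e\<close> of two strings can be realized, after scaling, at every position that leaves
  room for it. Let \<open>u\<close> approximate the desired end point. The string \<open>t\<close> followed by \<open>u\<close> lies in
  the window of \<open>t'\<close> followed by \<open>z\<close>, because the positions differ by \<open>q ^ (n0 + k) * e\<close>, and
  synchronization turns this near hit into an equation.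
\<close>

lemma sync_translate:
  assumes t: "t \<in> digits m i" "t' \<in> digits m i" and z: "z \<in> digits m k"
    and e: "e = val t' - val t"
    and lo: "0 \<le> q ^ (n0 + k) * e + q ^ n0 * val z + c"
    and hi: "q ^ (n0 + k) * e + q ^ n0 * val z + c \<le> maxval (n0 + k)"
  obtains x u where "x \<in> digits m n0" "u \<in> digits m (n0 + k)"
    "val u = q ^ n0 * val z + val x + q ^ (n0 + k) * e"
proof -
  obtain u where u: "u \<in> digits m (n0 + k)"
    "q ^ (n0 + k) * e + q ^ n0 * val z + c \<le> val u" "val u < q ^ (n0 + k) * e + q ^ n0 * val z + c + 1"
    using digit_values_dense[OF lo hi] by blast
  define T where "T = monom 1 k * t' + z"
  define g where "g = monom 1 (n0 + k) * t + u"
  have T: "T \<in> digits m (k + i)" and g: "g \<in> digits m (n0 + (k + i))"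
    using digits_append[OF z t(2)] digits_append[OF u(1) t(1)] by (simp_all add: T_def g_def add.assoc)
  have vT: "val T = q ^ k * val t' + val z" and vg: "val g = q ^ (n0 + k) * val t + val u"
    by (simp_all add: T_def g_def)
  have "q ^ n0 * val T + c \<le> val g" "val g \<le> q ^ n0 * val T + c + 1"
    using u(2,3) by (simp_all add: vT vg e power_add algebra_simps)
  then obtain x where x: "x \<in> digits m n0" "val g = q ^ n0 * val T + val x"
    using syncD[OF T g] by blast
  show ?thesis
    by (rule that[OF x(1) u(1)]) (use x(2) in \<open>simp add: vT vg e power_add algebra_simps\<close>)
qed

lemma exists_level: "\<exists>k. q ^ (n0 + k) + c \<le> maxval (n0 + k)"
proof -
  obtain j where j: "j \<ge> n0" "c + L < q ^ j * (L - 1)"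
    using exists_power_gt[of "L - 1" n0 "c + L"] L_gt_1 by auto
  thus ?thesis
    by (intro exI[of _ "j - n0"]) (simp add: maxval_def algebra_simps)
qed

text \<open>
  In particular, a difference in \<open>[0, 1]\<close> of strings of any length is, up to the factor
  \<open>q ^ j\<close>, a difference of strings of the fixed length \<open>j\<close>. So there are finitely many of them.
\<close>

lemma differences_at_fixed_level:
  obtains j where
    "\<And>i t t'. t \<in> digits m i \<Longrightarrow> t' \<in> digits m i \<Longrightarrow> val t \<le> val t' \<Longrightarrow> val t' \<le> val t + 1 \<Longrightarrow>
       \<exists>x\<in>digits m j. \<exists>u\<in>digits m j. val u = val x + q ^ j * (val t' - val t)"
proof -
  obtain k where k: "q ^ (n0 + k) + c \<le> maxval (n0 + k)" using exists_level by blast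
  show ?thesis
  proof (rule that[of "n0 + k"])
    fix i t t' assume t: "t \<in> digits m i" "t' \<in> digits m i" "val t \<le> val t'" "val t' \<le> val t + 1"
    define e where "e = val t' - val t"
    have e: "0 \<le> e" "e \<le> 1" using t by (auto simp: e_def)
    have "q ^ (n0 + k) * e \<le> q ^ (n0 + k) * 1" 
      using e q_gt_1 by (intro mult_left_mono) auto
    hence hi: "q ^ (n0 + k) * e + q ^ n0 * val 0 + c \<le> maxval (n0 + k)" using k by simp
    have lo: "0 \<le> q ^ (n0 + k) * e + q ^ n0 * val 0 + c" using e c_nonneg q_gt_1 by simp
    have z: "0 \<in> digits m k" using m_pos by (simp add: zero_in_digits)
    obtain x u where "x \<in> digits m n0" "u \<in> digits m (n0 + k)"
      "val u = q ^ n0 * val 0 + val x + q ^ (n0 + k) * e"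
      using sync_translate[OF t(1,2) z e_def lo hi] by blast
    thus "\<exists>x\<in>digits m (n0 + k). \<exists>u\<in>digits m (n0 + k). val u = val x + q ^ (n0 + k) * (val t' - val t)"
      using digits_mono[of x m n0 "n0 + k"] by (auto simp: e_def)
  qed
qed

text \<open>The difference \<open>1\<close> yields \<open>q ^ j = val u - val x\<close> with \<open>u\<close> and \<open>x\<close> of degree below \<open>j\<close>.\<close>

lemma algebraic_int_base: "algebraic_int q"
proof -
  obtain j where j: 
    "\<And>i t t'. t \<in> digits m i \<Longrightarrow> t' \<in> digits m i \<Longrightarrow> val t \<le> val t' \<Longrightarrow> val t' \<le> val t + 1 \<Longrightarrow>
       \<exists>x\<in>digits m j. \<exists>u\<in>digits m j. val u = val x + q ^ j * (val t' - val t)"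
    using differences_at_fixed_level by blast
  have "\<exists>x\<in>digits m j. \<exists>u\<in>digits m j. val u = val x + q ^ j * (val [:1:] - val 0)"
    using m_pos by (intro j[where i = "Suc 0"]) (auto intro!: const_in_digits zero_in_digits)
  then obtain x u where xu: "x \<in> digits m j" "u \<in> digits m j" "val u = val x + q ^ j" by auto
  define f where "f = monom 1 j + (x - u)"
  have low: "coeff (x - u) i = 0" if "i \<ge> j" for i using xu that by (auto simp: digits_def)
  have cf: "coeff f j = 1" "\<And>i. i > j \<Longrightarrow> coeff f i = 0" using low by (auto simp: f_def)
  hence deg: "degree f = j"
    by (metis le_degree degree_le order_antisym zero_neq_one)
  have "ipoly f q = 0" using xu(3) by (simp add: f_def)
  thus ?thesis
    unfolding algebraic_int_altdef_ipoly ipoly_def[symmetric] using cf(1) deg by blast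
qed

section \<open>Walking inside the interval\<close>

text \<open>
  At infinitely many scales, the number \<open>E\<close> is a difference of two strings of which the minuend
  sits, relative to the scale, as near as desired to \<open>\<xi>\<close>. The position is only approximate since each
  gluing shifts it by an amount that gets negligible at large scales.
\<close>

definition reach :: "real \<Rightarrow> real \<Rightarrow> bool" where
  "reach E \<xi> \<longleftrightarrow> (\<forall>\<eta>>0. \<forall>K. \<exists>k\<ge>K. \<exists>t\<in>digits m k. \<exists>t'\<in>digits m k.
      val t' - val t = q ^ k * E \<and> \<bar>val t' / q ^ k - \<xi>\<bar> < \<eta>)"

lemma reach_0:
  assumes "0 < \<xi>" "\<xi> < L"
  shows "reach 0 \<xi>"
  unfolding reach_def
proof (intro allI impI)
  fix \<eta> :: real and K :: nat assume \<eta>: "\<eta> > 0"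
  define \<rho> where "\<rho> = min \<eta> (L - \<xi>)"
  have "\<rho> > 0" using \<eta> assms by (simp add: \<rho>_def)
  then obtain k where k: "k \<ge> K" "L < q ^ k * \<rho>" using exists_power_gt by blast
  have qk: "q ^ k > 0" using q_gt_1 by simp
  have "q ^ k * \<rho> \<le> q ^ k * (L - \<xi>)" "q ^ k * \<rho> \<le> q ^ k * \<eta>"
    using qk by (intro mult_left_mono; simp add: \<rho>_def)+
  hence k': "\<xi> * q ^ k \<le> maxval k" "1 < q ^ k * \<eta>" 
    using k(2) L_gt_1 by (simp_all add: maxval_def algebra_simps)
  obtain t where t: "t \<in> digits m k" "\<xi> * q ^ k \<le> val t" "val t < \<xi> * q ^ k + 1"
    using digit_values_dense[OF _ k'(1)] assms qk by auto
  have "\<bar>val t / q ^ k - \<xi>\<bar> = (val t - \<xi> * q ^ k) / q ^ k"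
    using t(2) qk by (simp add: diff_divide_distrib pos_le_divide_eq)
  also have "\<dots> < \<eta>"
    using t(3) k'(2) qk by (simp add: field_simps)
  finally show "\<exists>k\<ge>K. \<exists>t\<in>digits m k. \<exists>t'\<in>digits m k.
      val t' - val t = q ^ k * 0 \<and> \<bar>val t' / q ^ k - \<xi>\<bar> < \<eta>"
    using t(1) k(1) by auto
qed

text \<open>
  To add \<open>e\<close> to \<open>E\<close> it suffices that \<open>e\<close> can be realized starting from some member of the
  synchronizing window of \<open>z\<close>, where \<open>z\<close> is the end point reached so far: that member has the
  value of \<open>z\<close> followed by some \<open>x\<close>, and the same \<open>x\<close> can be appended at the other end \<open>t\<close>.
\<close>

lemma reach_step:
  assumes "reach E \<xi>" "0 < \<xi> + e" "\<xi> + e < L" "0 < \<xi>" "\<xi> < L"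
    and step: "\<And>k z. z \<in> digits m k \<Longrightarrow> k > 0 \<Longrightarrow> 0 \<le> q ^ (n0 + k) * e + q ^ n0 * val z + c \<Longrightarrow>
       q ^ (n0 + k) * e + q ^ n0 * val z + c \<le> maxval (n0 + k) \<Longrightarrow> q ^ n0 * val z + c \<le> maxval (n0 + k) \<Longrightarrow>
       \<exists>x\<in>digits m n0. \<exists>u\<in>digits m (n0 + k). val u = q ^ n0 * val z + val x + q ^ (n0 + k) * e"
  shows "reach (E + e) (\<xi> + e)"
  unfolding reach_def
proof (intro allI impI)
  fix \<eta> :: real and K :: nat assume \<eta>: "\<eta> > 0"
  \<comment> \<open>The scale has to be so large that errors of size \<open>c\<close> and \<open>L\<close> do not reach the ends of the interval.\<close>
  define \<rho> where "\<rho> = min \<eta> (min (\<xi> + e) (min (L - (\<xi> + e)) (L - \<xi>)))"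
  have \<rho>: "\<rho> > 0" using \<eta> assms by (simp add: \<rho>_def)
  have "\<exists>k\<ge>max 1 K. c + L < q ^ k * (\<rho> / 2)"
    by (rule exists_power_gt) (use \<rho> in simp)
  then obtain K' where K': "K' \<ge> max 1 K" "c + L < q ^ K' * (\<rho> / 2)"
    by blast
  obtain k t z where k: "k \<ge> K'" and t: "t \<in> digits m k" and z: "z \<in> digits m k"
    and tz: "val z - val t = q ^ k * E" and pos: "\<bar>val z / q ^ k - \<xi>\<bar> < \<rho> / 2"
    using assms(1) \<rho> unfolding reach_def by (meson half_gt_zero)
  define j where "j = n0 + k"
  have qj: "q ^ j > 0" "q ^ k > 0" using q_gt_1 by auto
  have mono: "q ^ K' \<le> q ^ k" "q ^ k \<le> q ^ j"
    using q_gt_1 k by (auto intro!: power_increasing simp: j_def)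
  have big_k: "c + L < q ^ k * (\<rho> / 2)"
    using K'(2) mult_right_mono[OF mono(1), of "\<rho> / 2"] \<rho> by linarith
  have big_j: "c + L < q ^ j * (\<rho> / 2)"
    using big_k mult_right_mono[OF mono(2), of "\<rho> / 2"] \<rho> by linarith
  define w where "w = val z / q ^ k"
  have w: "q ^ n0 * val z = q ^ j * w" using qj by (simp add: w_def j_def power_add)
  have pos': "\<bar>w - \<xi>\<bar> < \<rho> / 2" using pos by (simp add: w_def)
  have "0 \<le> e + w" using pos' \<rho>_def by linarith
  hence lo: "0 \<le> q ^ j * e + q ^ n0 * val z + c"
    using qj c_nonneg unfolding w by (simp flip: distrib_left)
  have "e + w + \<rho> / 2 \<le> L" using pos' \<rho>_def by linarith
  hence "q ^ j * (e + w + \<rho> / 2) \<le> q ^ j * L" using qj by (intro mult_left_mono) auto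
  hence hi: "q ^ j * e + q ^ n0 * val z + c \<le> maxval j"
    using big_j unfolding w by (simp add: maxval_def algebra_simps)
  have "w + \<rho> / 2 \<le> L" using pos' \<rho>_def by linarith
  hence "q ^ j * (w + \<rho> / 2) \<le> q ^ j * L" using qj by (intro mult_left_mono) auto
  hence hi': "q ^ n0 * val z + c \<le> maxval j"
    using big_j unfolding w by (simp add: maxval_def algebra_simps)
  obtain x u where x: "x \<in> digits m n0" and u: "u \<in> digits m j"
    and vu: "val u = q ^ n0 * val z + val x + q ^ j * e"
    using step[OF z] lo hi hi' K'(1) k unfolding j_def by force
  define s where "s = monom 1 n0 * t + x"
  have s: "s \<in> digits m j" unfolding s_def j_def by (rule digits_append[OF x t])
  have diff: "val u - val s = q ^ j * (E + e)"
    using tz by (simp add: s_def vu j_def power_add algebra_simps)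

  have "val x / q ^ j < \<rho> / 2"
  proof -
    have "val x \<le> L * q ^ n0"
      using val_le_maxval[OF x] L_gt_1 by (simp add: maxval_def algebra_simps)
    also have "\<dots> < q ^ n0 * (q ^ k * (\<rho> / 2))"
      using big_k c_nonneg q_gt_1 by simp
    finally show ?thesis using qj by (simp add: field_simps j_def power_add)
  qed
  moreover have "val u / q ^ j - (\<xi> + e) = (w - \<xi>) + val x / q ^ j"
    using qj by (simp add: vu w field_simps)
  moreover have "0 \<le> val x / q ^ j" using val_nonneg[OF x] qj by simp
  ultimately have "\<bar>val u / q ^ j - (\<xi> + e)\<bar> < \<rho>"
    using pos' by linarith
  hence "\<bar>val u / q ^ j - (\<xi> + e)\<bar> < \<eta>" by (simp add: \<rho>_def)
  moreover have "j \<ge> K" using K'(1) k by (simp add: j_def)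
  ultimately show "\<exists>k\<ge>K. \<exists>t\<in>digits m k. \<exists>t'\<in>digits m k.
      val t' - val t = q ^ k * (E + e) \<and> \<bar>val t' / q ^ k - (\<xi> + e)\<bar> < \<eta>"
    using s u diff by blast
qed

lemma reach_step_difference:
  assumes "reach E \<xi>" "0 < \<xi> + e" "\<xi> + e < L" "0 < \<xi>" "\<xi> < L"
    and "t \<in> digits m i" "t' \<in> digits m i" "e = val t' - val t"
  shows "reach (E + e) (\<xi> + e)"
  using assms(1-5)
proof (rule reach_step)
  fix k z assume "z \<in> digits m k" "0 \<le> q ^ (n0 + k) * e + q ^ n0 * val z + c"
    "q ^ (n0 + k) * e + q ^ n0 * val z + c \<le> maxval (n0 + k)"
  from sync_translate[OF assms(6,7) this(1) assms(8) this(2,3)]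
  show "\<exists>x\<in>digits m n0. \<exists>u\<in>digits m (n0 + k). val u = q ^ n0 * val z + val x + q ^ (n0 + k) * e"
    by blast
qed

text \<open>
  As \<open>1/q\<close> need not be a difference of strings, \<open>sync_translate\<close> does not apply. But in every
  window that leaves room for the step there is a string whose leading digit can be decreased.
\<close>

lemma reach_step_down_inverse:
  assumes "reach E \<xi>" "0 < \<xi> - 1 / q" "\<xi> < L"
  shows "reach (E - 1 / q) (\<xi> - 1 / q)"
proof -
  have "reach (E + (- 1 / q)) (\<xi> + (- 1 / q))"
  proof (rule reach_step[OF assms(1)])
    have "1 / q > 0" using q_gt_1 by simp
    thus "0 < \<xi> + - 1 / q" "\<xi> + - 1 / q < L" "0 < \<xi>" "\<xi> < L"
      using assms unfolding minus_divide_left[symmetric] by linarith+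
  next
    fix k z assume z: "z \<in> digits m k" and "k > 0"
      and lo: "0 \<le> q ^ (n0 + k) * (- 1 / q) + q ^ n0 * val z + c"
      and hi: "q ^ n0 * val z + c \<le> maxval (n0 + k)"
    obtain n where n: "n0 + k = Suc n" using \<open>k > 0\<close> by (cases "n0 + k") auto
    have qn: "q ^ (n0 + k) * (- 1 / q) = - (q ^ n)" using q_gt_1 by (simp add: n)
    obtain b v where bv: "0 \<le> b" "b < m" "v \<in> digits m n"
      "q ^ n0 * val z + c - q ^ n \<le> of_int b * q ^ n + val v"
      "of_int b * q ^ n + val v < q ^ n0 * val z + c - q ^ n + 1"
      by (rule dense_below_top_digit[of "q ^ n0 * val z + c - q ^ n" n])
         (use lo hi in \<open>simp_all add: qn n\<close>)
    have u: "monom b n + v \<in> digits m (n0 + k)" and g: "monom (b + 1) n + v \<in> digits m (n0 + k)"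
      using bv by (auto simp: n intro!: digits_top)
    have vg: "val (monom (b + 1) n + v) = val (monom b n + v) + q ^ n" by (simp add: algebra_simps)
    obtain x where x: "x \<in> digits m n0" "val (monom (b + 1) n + v) = q ^ n0 * val z + val x"
      by (rule syncD[OF z g]) (use bv(4,5) in \<open>simp_all add: algebra_simps\<close>)
    show "\<exists>x\<in>digits m n0. \<exists>u\<in>digits m (n0 + k). val u = q ^ n0 * val z + val x + q ^ (n0 + k) * (- 1 / q)"
      unfolding qn using vg x u by (intro bexI[OF _ x(1)] bexI[OF _ u]) linarith
  qed
  thus ?thesis by simp
qed

text \<open>
  Upward steps by \<open>d\<close> and downward steps by \<open>1/q\<close> can be ordered so that the walk stays inside
  \<open>(0, L)\<close>: as \<open>d + 1/q < L\<close>, one of the two is possible from any position, and once only one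
  kind of step is left, the walk is monotone and ends inside.
\<close>

lemma reach_walk:
  fixes a b :: nat
  assumes t: "t \<in> digits m i" "t' \<in> digits m i" "d = val t' - val t"
    and d: "0 < d" "d + 1 / q < L"
  shows "reach E \<xi> \<Longrightarrow> 0 < \<xi> \<Longrightarrow> \<xi> < L \<Longrightarrow> 0 < \<xi> + (of_nat a * d - of_nat b / q) \<Longrightarrow>
     \<xi> + (of_nat a * d - of_nat b / q) < L \<Longrightarrow>
     reach (E + (of_nat a * d - of_nat b / q)) (\<xi> + (of_nat a * d - of_nat b / q))"
proof (induction "a + b" arbitrary: a b E \<xi>)
  case 0
  thus ?case by simp
next
  case (Suc n)
  have inv: "1 / q > 0" using q_gt_1 by simp
  have up: "?case" if room: "0 < a" "\<xi> + d < L"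
  proof -
    obtain a' where a': "a = Suc a'" using room(1) by (cases a) auto
    have r: "reach (E + d) (\<xi> + d)"
      using Suc.prems room d(1) t by (intro reach_step_difference) auto
    have "reach (E + d + (of_nat a' * d - of_nat b / q)) (\<xi> + d + (of_nat a' * d - of_nat b / q))"
      using Suc.prems Suc.hyps(2) room d(1)
      by (intro Suc.hyps(1)[OF _ r]) (auto simp: a' algebra_simps)
    thus ?thesis by (simp add: a' algebra_simps)
  qed
  have down: "?case" if room: "0 < b" "0 < \<xi> - 1 / q"
  proof -
    obtain b' where b': "b = Suc b'" using room(1) by (cases b) auto
    have below: "\<xi> - 1 / q < L" using Suc.prems(3) inv by linarith
    have r: "reach (E - 1 / q) (\<xi> - 1 / q)"
      using Suc.prems room by (intro reach_step_down_inverse) auto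
    have "reach (E - 1 / q + (of_nat a * d - of_nat b' / q)) (\<xi> - 1 / q + (of_nat a * d - of_nat b' / q))"
      using Suc.prems Suc.hyps(2) room below
      by (intro Suc.hyps(1)[OF _ r]) (auto simp: b' algebra_simps add_divide_distrib)
    thus ?thesis by (simp add: b' algebra_simps add_divide_distrib)
  qed
  consider "a = 0" "b > 0" | "b = 0" "a > 0" | "a > 0" "b > 0" using Suc.hyps(2) by (cases "a = 0"; cases "b = 0") auto
  thus ?case
  proof cases
    case 1
    have "1 / q \<le> of_nat b / q" using 1 q_gt_1 by (simp add: field_simps)
    thus ?thesis using down 1 Suc.prems by simp
  next
    case 2
    have "1 * d \<le> of_nat a * d" using 2 d(1) by (intro mult_right_mono) auto
    thus ?thesis using up 2 Suc.prems by simp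
  next
    case 3
    have "\<xi> + d < L \<or> 0 < \<xi> - 1 / q" using d(2) by linarith
    thus ?thesis using up down 3 by blast
  qed
qed

lemma combination_is_difference:
  fixes a b :: nat
  assumes t: "t \<in> digits m i" "t' \<in> digits m i" "d = val t' - val t"
    and d: "0 < d" "d + 1 / q < L"
    and bd: "\<bar>of_nat a * d - of_nat b / q\<bar> < L"
  obtains n s s' where "s \<in> digits m (Suc n)" "s' \<in> digits m (Suc n)"
    "val s' - val s = q ^ n * (q * of_nat a * d - of_nat b)"
proof -
  define e where "e = of_nat a * d - of_nat b / q"
  \<comment> \<open>The start \<open>\<xi>\<close> and the end \<open>\<xi> + e\<close> are placed symmetrically about the centre of the interval.\<close>
  define \<xi> where "\<xi> = (L - e) / 2"
  have \<xi>: "0 < \<xi>" "\<xi> < L" "0 < \<xi> + e" "\<xi> + e < L"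
    using bd[folded e_def] by (auto simp: \<xi>_def field_simps abs_less_iff)
  have "reach (0 + e) (\<xi> + e)"
    unfolding e_def by (rule reach_walk[OF t d reach_0]) (use \<xi> in \<open>simp_all add: e_def\<close>)
  hence "\<exists>k\<ge>1. \<exists>s\<in>digits m k. \<exists>s'\<in>digits m k. val s' - val s = q ^ k * (0 + e) \<and> \<bar>val s' / q ^ k - (\<xi> + e)\<bar> < 1"
    unfolding reach_def using zero_less_one by blast
  then obtain k s s' where k: "k \<ge> 1" "s \<in> digits m k" "s' \<in> digits m k" "val s' - val s = q ^ k * e"
    by auto
  obtain n where n: "k = Suc n" using k(1) by (cases k) auto
  show ?thesis
    by (rule that[of s n s']) (use k in \<open>simp_all add: n e_def right_diff_distrib\<close>)
qed

end

section \<open>Roots of polynomials with decreasing coefficients\<close>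

text \<open>
  The theorem of Enestroem and Kakeya, with a strict conclusion. With \<open>x = 1/p\<close>, multiplying the
  sum by \<open>1 - x\<close> represents \<open>r 0\<close> as a combination of powers of \<open>x\<close> whose weights
  \<open>r i - r (Suc i)\<close> are nonnegative with sum \<open>r 0\<close>. As the powers lie in the unit disc, each power with
  positive weight is \<open>1\<close>, in particular \<open>x\<close> itself.
\<close>

lemma enestroem_kakeya:
  fixes r :: "nat \<Rightarrow> real" and p :: complex
  assumes nonneg: "\<And>i. 0 \<le> r i" and dec: "\<And>i. r (Suc i) \<le> r i" and "r 1 < r 0" "r (Suc l) = 0"
    and "norm p \<ge> 1"
  shows "(\<Sum>i\<le>l. of_real (r i) * p ^ (l - i)) \<noteq> 0"
proof
  assume zero: "(\<Sum>i\<le>l. of_real (r i) * p ^ (l - i)) = 0"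
  define x where "x = inverse p"
  have p0: "p \<noteq> 0" using assms(5) by auto
  have x1: "norm x \<le> 1" using assms(5) by (simp add: x_def norm_inverse inverse_le_1_iff)
  have pow: "norm (x ^ i) \<le> 1" for i using x1 by (simp add: norm_power power_le_one)
  have re: "Re (x ^ i) \<le> 1" for i using pow[of i] complex_Re_le_cmod[of "x ^ i"] by linarith
  have "(\<Sum>i\<le>l. of_real (r i) * x ^ i) = x ^ l * (\<Sum>i\<le>l. of_real (r i) * p ^ (l - i))"
    unfolding sum_distrib_left
  proof (rule sum.cong)
    fix i assume "i \<in> {..l}"
    hence "x ^ l = x ^ i * x ^ (l - i)" by (simp flip: power_add)
    moreover have "x ^ (l - i) * p ^ (l - i) = 1"
      using p0 by (simp add: x_def flip: power_mult_distrib)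
    ultimately show "of_real (r i) * x ^ i = x ^ l * (of_real (r i) * p ^ (l - i))"
      by (simp add: mult.assoc mult.left_commute)
  qed simp
  with zero have S: "(\<Sum>i\<le>l. of_real (r i) * x ^ i) = 0" by simp
  have "(1 - x) * (\<Sum>i\<le>n. of_real (r i) * x ^ i) =
      of_real (r 0) - (\<Sum>i\<le>n. of_real (r i - r (Suc i)) * x ^ Suc i) - of_real (r (Suc n)) * x ^ Suc n" for n
    by (induction n) (simp_all add: algebra_simps)
  from this[of l] S have "of_real (r 0) = (\<Sum>i\<le>l. of_real (r i - r (Suc i)) * x ^ Suc i)"
    using assms(4) by simp
  hence "r 0 = (\<Sum>i\<le>l. (r i - r (Suc i)) * Re (x ^ Suc i))"
    by (simp add: complex_eq_iff del: power_Suc of_real_diff)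
  moreover have "r 0 = (\<Sum>i\<le>l. r i - r (Suc i))"
    using assms(4) by (simp add: sum_telescope)
  ultimately have "(\<Sum>i\<le>l. (r i - r (Suc i)) * (1 - Re (x ^ Suc i))) = 0"
    by (simp add: right_diff_distrib sum_subtractf del: power_Suc)
  moreover have "0 \<le> (r i - r (Suc i)) * (1 - Re (x ^ Suc i))" for i
    using dec[of i] re[of "Suc i"] by (simp del: power_Suc)
  ultimately have "(r 0 - r (Suc 0)) * (1 - Re (x ^ Suc 0)) = 0"
    by (subst (asm) sum_nonneg_eq_0_iff) auto
  hence "Re x = 1" using assms(3) by simp
  hence "x = 1" using x1 cmod_power2[of x] power_le_one[of "norm x" 2]
    by (simp add: complex_eq_iff)
  hence "of_real (\<Sum>i\<le>l. r i) = (0 :: complex)" using S by simp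
  hence "(\<Sum>i\<le>l. r i) = 0" by (simp only: of_real_eq_0_iff)
  hence "r 0 = 0" using nonneg by (subst (asm) sum_nonneg_eq_0_iff) auto
  thus False using assms(3) nonneg[of 1] by simp
qed

section \<open>Conjugates of the base\<close>

text \<open>
  Evaluation at \<open>z\<close> factors through evaluation at \<open>q\<close>: there is a ring homomorphism
  \<open>\<int>[q] \<rightarrow> \<int>[z]\<close> sending \<open>q\<close> to \<open>z\<close>.
\<close>

definition conjugate_to :: "real \<Rightarrow> 'a :: comm_ring_1 \<Rightarrow> bool" where
  "conjugate_to q z \<longleftrightarrow> (\<forall>f. ipoly f q = 0 \<longrightarrow> ipoly f z = 0)"

lemma conjugate_to_eq:
  assumes "conjugate_to q z" "ipoly f q = ipoly g q"
  shows "ipoly f z = ipoly g z"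
proof -
  have "ipoly (f - g) q = 0" using assms(2) by simp
  hence "ipoly (f - g) z = 0" using assms(1) unfolding conjugate_to_def by blast
  thus ?thesis by simp
qed

lemma zero_if_multiples_bounded:
  fixes x B :: real
  assumes "0 \<le> x" "\<And>a::nat. of_nat a * x \<le> B"
  shows "x = 0"
proof (rule ccontr)
  assume "x \<noteq> 0"
  then obtain a :: nat where "B < of_nat a * x" using assms(1) reals_Archimedean3[of x] by auto
  with assms(2)[of a] show False by simp
qed

context synchronized_digits
begin

text \<open>
  The walk, applied to \<open>a * d - b / q\<close> where \<open>b\<close> is the integer part of \<open>a * q * d\<close>, and scaled so
  that the right-hand side is a polynomial in \<open>q\<close>.
\<close>

lemma combination_polynomial:
  fixes a :: nat
  assumes t: "t \<in> digits m i" "t' \<in> digits m i" "d = val t' - val t"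
    and d: "0 < d" "d + 1 / q < L"
  obtains n b s s' where "s \<in> digits m (Suc n)" "s' \<in> digits m (Suc n)"
    "val s' - val s = q ^ n * (of_nat a * (q * ipoly (t' - t) q) - of_nat b)"
    "of_nat b \<le> of_nat a * (q * d)" "of_nat a * (q * d) < of_nat b + 1"
proof -
  define b where "b = nat \<lfloor>of_nat a * (q * d)\<rfloor>"
  have pos: "0 \<le> of_nat a * (q * d)" using d(1) q_gt_1 by simp
  have b: "of_nat b \<le> of_nat a * (q * d)" "of_nat a * (q * d) < of_nat b + 1"
    using pos by (simp_all add: b_def)
  have "\<bar>of_nat a * d - of_nat b / q\<bar> = \<bar>of_nat a * (q * d) - of_nat b\<bar> / q"
  proof -
    have "of_nat a * d - of_nat b / q = (of_nat a * (q * d) - of_nat b) / q"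
      by (simp add: field_simps)
    thus ?thesis using q_gt_1 by (simp add: abs_divide)
  qed
  also have "\<dots> < 1" using b q_gt_1 by (simp add: field_simps)
  finally have bd: "\<bar>of_nat a * d - of_nat b / q\<bar> < L" using L_gt_1 by linarith
  obtain n s s' where "s \<in> digits m (Suc n)" "s' \<in> digits m (Suc n)"
    "val s' - val s = q ^ n * (q * of_nat a * d - of_nat b)"
    using combination_is_difference[OF t d bd] by blast
  thus ?thesis using that[of s n s' b] b t(3) by (simp add: mult_ac)
qed

lemma combination_conjugate:
  assumes "val s' - val s = q ^ n * (of_nat a * (q * ipoly r q) - of_nat b)" "conjugate_to q z"
  shows "ipoly s' z - ipoly s z = z ^ n * (of_nat a * (z * ipoly r z) - of_nat b)"
proof -
  have "ipoly (s' - s) z = ipoly (monom 1 n * (smult (int a) (pCons 0 r) - [:int b:])) z"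
    using assms(2) by (rule conjugate_to_eq) (use assms(1) in \<open>simp add: algebra_simps\<close>)
  thus ?thesis by (simp add: algebra_simps)
qed

text \<open>
  In base \<open>p\<close>, a difference of strings of length \<open>Suc n\<close> has size \<open>O(norm p ^ n)\<close>. Comparing the
  two readings of the equation of the walk, \<open>a * p * r(p) - b\<close> is bounded for \<open>r = t' - t\<close>, and so is
  \<open>a * q * r(q) - b\<close> by the choice of \<open>b\<close>. As \<open>a\<close> is arbitrary, \<open>p * r(p) = q * r(q)\<close>.
\<close>

lemma conjugate_outside:
  fixes p :: complex
  assumes t: "t \<in> digits m i" "t' \<in> digits m i" "d = val t' - val t"
    and d: "0 < d" "d + 1 / q < L"
    and p: "conjugate_to q p" "norm p > 1"
  shows "p * ipoly (t' - t) p = of_real (q * d)"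
proof -
  define B where "B = of_int m * (norm p / (norm p - 1))"
  have bound: "of_nat a * norm (p * ipoly (t' - t) p - of_real (q * d)) \<le> B + 1" for a
  proof -
    obtain n b s s' where s: "s \<in> digits m (Suc n)" "s' \<in> digits m (Suc n)"
      and eq: "val s' - val s = q ^ n * (of_nat a * (q * ipoly (t' - t) q) - of_nat b)"
      and b: "of_nat b \<le> of_nat a * (q * d)" "of_nat a * (q * d) < of_nat b + 1"
      by (rule combination_polynomial[OF t d])
    define y where "y = of_nat a * (p * ipoly (t' - t) p) - of_nat b"
    have "norm p ^ n * norm y = norm (ipoly s' p - ipoly s p)"
      using combination_conjugate[OF eq p(1)] by (simp add: y_def norm_mult norm_power)
    also have "\<dots> \<le> of_int m * (\<Sum>i<Suc n. norm p ^ i)"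
      by (rule norm_ipoly_digits_diff_le[OF s(2,1)])
    also have "(\<Sum>i<Suc n. norm p ^ i) = (norm p ^ Suc n - 1) / (norm p - 1)"
      using p(2) geometric_sum[of "norm p" "Suc n"] by simp
    also have "of_int m * \<dots> \<le> of_int m * (norm p ^ Suc n / (norm p - 1))"
      using p(2) m_pos by (intro mult_left_mono divide_right_mono) auto
    also have "\<dots> = norm p ^ n * B" by (simp add: B_def)
    finally have "norm p ^ n * norm y \<le> norm p ^ n * B" .
    moreover have "norm p ^ n > 0" using p(2) by (intro zero_less_power) linarith
    ultimately have y: "norm y \<le> B" by (rule mult_left_le_imp_le)
    have "of_nat a * norm (p * ipoly (t' - t) p - of_real (q * d)) = 
        norm (of_nat a * (p * ipoly (t' - t) p - of_real (q * d)))" by (simp add: norm_mult)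
    also have "of_nat a * (p * ipoly (t' - t) p - of_real (q * d)) = y - of_real (of_nat a * (q * d) - of_nat b)"
      by (simp add: y_def algebra_simps)
    also have "norm \<dots> \<le> norm y + \<bar>of_nat a * (q * d) - of_nat b\<bar>"
      by (metis norm_of_real norm_triangle_ineq4)
    finally show ?thesis using y b by linarith
  qed
  have "norm (p * ipoly (t' - t) p - of_real (q * d)) = 0"
    by (rule zero_if_multiples_bounded[OF _ bound]) simp
  thus ?thesis by simp
qed

text \<open>
  On the unit circle, the estimate used for \<open>norm p > 1\<close> becomes linear in the length of the
  strings, and the walk has no control over that length. The next two lemmas provide a bound by the size of the
  difference in base \<open>q\<close> instead. Differences up to \<open>1\<close> are harmless since they occur at one
  fixed length, and a larger one splits into such, none of them smaller than the separation constant.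
\<close>

lemma unit_circle_lipschitz:
  fixes p :: complex
  assumes p: "conjugate_to q p" "norm p = 1"
  obtains B where "0 \<le> B" "\<And>n k f g. f \<in> digits m k \<Longrightarrow> g \<in> digits m k \<Longrightarrow> \<bar>val f - val g\<bar> \<le> of_nat n * \<delta> \<Longrightarrow>
     norm (ipoly f p - ipoly g p) \<le> of_nat n * B"
proof -
  obtain j where j: 
    "\<And>i t t'. t \<in> digits m i \<Longrightarrow> t' \<in> digits m i \<Longrightarrow> val t \<le> val t' \<Longrightarrow> val t' \<le> val t + 1 \<Longrightarrow>
       \<exists>x\<in>digits m j. \<exists>u\<in>digits m j. val u = val x + q ^ j * (val t' - val t)"
    using differences_at_fixed_level by blast
  define B where "B = real_of_int m * real j"
  have B: "0 \<le> B" using m_pos by (simp add: B_def)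
  have close: "norm (ipoly f p - ipoly g p) \<le> B"
    if fg: "f \<in> digits m k" "g \<in> digits m k" "val g \<le> val f" "val f \<le> val g + 1" for f g k
  proof -
    obtain x u where xu: "x \<in> digits m j" "u \<in> digits m j" "val u = val x + q ^ j * (val f - val g)"
      using j[OF fg(2,1,3,4)] by blast
    have "ipoly (u - x) p = ipoly (monom 1 j * (f - g)) p"
      using p(1) by (rule conjugate_to_eq) (use xu(3) in simp)
    hence "norm (ipoly f p - ipoly g p) = norm (ipoly u p - ipoly x p)"
      using p(2) by (simp add: norm_mult norm_power)
    also have "\<dots> \<le> B"
      using norm_ipoly_digits_diff_le[OF xu(2,1), of p] p(2) by (simp add: B_def)
    finally show ?thesis .
  qed
  have ordered: "norm (ipoly f p - ipoly g p) \<le> of_nat n * B"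
    if "f \<in> digits m k" "g \<in> digits m k" "val g \<le> val f" "val f - val g \<le> of_nat n * \<delta>" for n k f g
    using that
  proof (induction n arbitrary: f)
    case 0
    hence "val f = val g" by simp
    hence "ipoly f p = ipoly g p" by (rule conjugate_to_eq[OF p(1)])
    thus ?case by simp
  next
    case (Suc n)
    show ?case
    proof (cases "val f \<le> val g + 1")
      case True
      have "B \<le> of_nat (Suc n) * B" using B by (simp add: algebra_simps)
      thus ?thesis using close[OF Suc.prems(1,2,3) True] by linarith
    next
      case False
      have "0 \<le> val f - 1" "val f - 1 \<le> maxval k"
        using False val_nonneg[OF Suc.prems(2)] val_le_maxval[OF Suc.prems(1)] by auto
      then obtain h where h: "h \<in> digits m k" "val f - 1 \<le> val h" "val h < val f"
        using digit_values_dense[of "val f - 1" k] by auto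
      have "\<delta> \<le> val f - val h"
        using separated[OF Suc.prems(1) h(1)] h(3) by auto
      hence "norm (ipoly h p - ipoly g p) \<le> of_nat n * B"
        using Suc.prems False h by (intro Suc.IH) (auto simp: algebra_simps)
      moreover have "norm (ipoly f p - ipoly h p) \<le> B"
        using h Suc.prems(1) by (intro close) auto
      ultimately show ?thesis
        using norm_triangle_ineq[of "ipoly f p - ipoly h p" "ipoly h p - ipoly g p"]
        by (simp add: algebra_simps)
    qed
  qed
  show ?thesis
  proof (rule that[OF B])
    fix n k f g assume fg: "f \<in> digits m k" "g \<in> digits m k" "\<bar>val f - val g\<bar> \<le> of_nat n * \<delta>"
    show "norm (ipoly f p - ipoly g p) \<le> of_nat n * B"
    proof (cases "val g \<le> val f")
      case True
      with fg show ?thesis by (intro ordered) auto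
    next
      case False
      with fg have "norm (ipoly g p - ipoly f p) \<le> of_nat n * B" by (intro ordered) auto
      thus ?thesis by (simp add: norm_minus_commute)
    qed
  qed
qed

text \<open>
  Only the part of the strings above the lowest \<open>n\<close> digits is subject to the Lipschitz bound, and
  after division by \<open>q ^ n\<close> it has bounded differences. The lowest \<open>n\<close> digits contribute at most
  \<open>m\<close> each.
\<close>

lemma unit_circle_logarithmic:
  fixes p :: complex
  assumes p: "conjugate_to q p" "norm p = 1"
  obtains B where "\<And>n k f g. f \<in> digits m k \<Longrightarrow> g \<in> digits m k \<Longrightarrow> \<bar>val f - val g\<bar> \<le> C * q ^ n \<Longrightarrow>
     norm (ipoly f p - ipoly g p) \<le> B + of_int m * of_nat n"
proof -
  obtain B where B: "0 \<le> B" "\<And>n k f g. f \<in> digits m k \<Longrightarrow> g \<in> digits m k \<Longrightarrow> \<bar>val f - val g\<bar> \<le> of_nat n * \<delta> \<Longrightarrow>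
     norm (ipoly f p - ipoly g p) \<le> of_nat n * B"
    using unit_circle_lipschitz[OF p] by blast
  obtain N :: nat where N: "C + L < of_nat N * \<delta>"
    using reals_Archimedean3[OF \<delta>_pos] by blast
  show ?thesis
  proof (rule that[of "of_nat N * B"])
    fix n k f g assume f: "f \<in> digits m k" and g: "g \<in> digits m k" and fg: "\<bar>val f - val g\<bar> \<le> C * q ^ n"
    have "f \<in> digits m (n + k)" "g \<in> digits m (n + k)"
      using f g digits_mono by auto
    moreover obtain f0 f1 where "f0 \<in> digits m n" "f1 \<in> digits m k" "f = monom 1 n * f1 + f0"
      using calculation(1) by (rule digits_split)
    moreover obtain g0 g1 where "g0 \<in> digits m n" "g1 \<in> digits m k" "g = monom 1 n * g1 + g0"
      using calculation(2) by (rule digits_split)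
    ultimately have
      0: "f0 \<in> digits m n" "g0 \<in> digits m n" and 1: "f1 \<in> digits m k" "g1 \<in> digits m k" and
      eq: "f = monom 1 n * f1 + f0" "g = monom 1 n * g1 + g0"
      by simp_all
    have qn: "q ^ n > 0" using q_gt_1 by simp
    have "maxval n \<le> L * q ^ n" using L_gt_1 by (simp add: maxval_def algebra_simps)
    hence low: "\<bar>val f0 - val g0\<bar> \<le> L * q ^ n"
      using val_le_maxval[OF 0(1)] val_le_maxval[OF 0(2)] val_nonneg[OF 0(1)] val_nonneg[OF 0(2)] by linarith
    have "q ^ n * \<bar>val f1 - val g1\<bar> = \<bar>(val f - val g) - (val f0 - val g0)\<bar>"
      using qn by (simp add: eq abs_mult_pos' right_diff_distrib)
    also have "\<dots> \<le> q ^ n * (C + L)" using fg low by (simp add: algebra_simps)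
    finally have "\<bar>val f1 - val g1\<bar> \<le> C + L" using qn by simp
    hence up: "norm (ipoly f1 p - ipoly g1 p) \<le> of_nat N * B"
      using N by (intro B(2)[OF 1]) linarith
    have "ipoly f p - ipoly g p = p ^ n * (ipoly f1 p - ipoly g1 p) + (ipoly f0 p - ipoly g0 p)"
      by (simp add: eq algebra_simps)
    also have "norm \<dots> \<le> norm (ipoly f1 p - ipoly g1 p) + norm (ipoly f0 p - ipoly g0 p)"
      by (rule order.trans[OF norm_triangle_ineq]) (simp add: norm_mult norm_power p(2))
    also have "norm (ipoly f0 p - ipoly g0 p) \<le> of_int m * of_nat n"
      using norm_ipoly_digits_diff_le[OF 0, of p] p(2) by simp
    finally show "norm (ipoly f p - ipoly g p) \<le> of_nat N * B + of_int m * of_nat n" using up by simp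
  qed
qed

text \<open>
  If \<open>1/q\<close> is a conjugate as well, the equation of the walk can be read in base \<open>1/q\<close>, where it
  says, for the reversed strings in base \<open>q\<close>, that their values differ by \<open>a * \<theta>' - b\<close> with
  \<open>\<theta>' = r(1/q) / q\<close>, regardless of their length. This is \<open>O(a)\<close>, so that the reversed strings
  differ by \<open>O(log a)\<close> in base \<open>p\<close>. But this latter difference is \<open>a * p * r(p) - b\<close> up to conjugation and
  a factor of modulus \<open>1\<close>, whereas \<open>a * q * r(q) - b\<close> is bounded. Hence again \<open>p * r(p) = q * r(q)\<close>.
\<close>

lemma conjugate_on_unit_circle:
  fixes p :: complex
  assumes t: "t \<in> digits m i" "t' \<in> digits m i" "d = val t' - val t"
    and d: "0 < d" "d + 1 / q < L"
    and p: "conjugate_to q p" "norm p = 1" and recip: "conjugate_to q (inverse q)"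
  shows "p * ipoly (t' - t) p = of_real (q * d)"
proof -
  define \<theta> where "\<theta> = q * d"
  define \<theta>' where "\<theta>' = inverse q * ipoly (t' - t) (inverse q)"
  define D where "D = norm (p * ipoly (t' - t) p - of_real \<theta>)"
  have \<theta>: "\<theta> > 0" using d(1) q_gt_1 by (simp add: \<theta>_def)
  have cnjp: "inverse p = cnj p"
    using p(2) by (intro inverse_unique) (simp flip: complex_norm_square)
  have p0: "p \<noteq> 0" using p(2) by auto
  obtain B where B: "\<And>n k f g. f \<in> digits m k \<Longrightarrow> g \<in> digits m k \<Longrightarrow> \<bar>val f - val g\<bar> \<le> (\<bar>\<theta>'\<bar> + \<theta>) * q ^ n \<Longrightarrow>
     norm (ipoly f p - ipoly g p) \<le> B + of_int m * of_nat n"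
    using unit_circle_logarithmic[OF p, where C = "\<bar>\<theta>'\<bar> + \<theta>"] by blast
  have bound: "(q ^ n - 1) * D \<le> 1 + B + of_int m * of_nat n" for n
  proof -
    \<comment> \<open>With \<open>a\<close> of order \<open>q ^ n\<close>, the logarithmic bound is linear in \<open>n\<close>.\<close>
    define a where "a = nat \<lfloor>q ^ n\<rfloor>"
    have "q ^ n > 0" using q_gt_1 by simp
    hence a: "of_nat a \<le> q ^ n" "q ^ n - 1 \<le> of_nat a"
      unfolding a_def by linarith+
    obtain k b s s' where s: "s \<in> digits m (Suc k)" "s' \<in> digits m (Suc k)"
      and eq: "val s' - val s = q ^ k * (of_nat a * (q * ipoly (t' - t) q) - of_nat b)"
      and b: "of_nat b \<le> of_nat a * \<theta>" "of_nat a * \<theta> < of_nat b + 1"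
      unfolding \<theta>_def by (rule combination_polynomial[OF t d])
    define f where "f = reverse_digits (Suc k) s'"
    define g where "g = reverse_digits (Suc k) s"
    have fg: "f \<in> digits m (Suc k)" "g \<in> digits m (Suc k)"
      using s by (simp_all add: f_def g_def reverse_digits_in_digits)
    define y where "y = of_nat a * (p * ipoly (t' - t) p) - of_nat b"
    have "val f - val g = q ^ k * (ipoly s' (inverse q) - ipoly s (inverse q))"
      using s by (simp add: f_def g_def ipoly_reverse_digits right_diff_distrib)
    also have "\<dots> = of_nat a * \<theta>' - of_nat b"
      using combination_conjugate[OF eq recip] q_gt_1 by (simp add: \<theta>'_def power_inverse)
    finally have "\<bar>val f - val g\<bar> \<le> of_nat a * \<bar>\<theta>'\<bar> + of_nat b"
      using abs_triangle_ineq4[of "of_nat a * \<theta>'" "of_nat b"] by (simp add: abs_mult)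
    also have "\<dots> \<le> (\<bar>\<theta>'\<bar> + \<theta>) * of_nat a" using b by (simp add: algebra_simps)
    also have "\<dots> \<le> (\<bar>\<theta>'\<bar> + \<theta>) * q ^ n" using a \<theta> by (intro mult_left_mono) auto
    finally have "norm (ipoly f p - ipoly g p) \<le> B + of_int m * of_nat n" by (rule B[OF fg])
    also have "ipoly f p - ipoly g p = p ^ k * cnj (ipoly s' p - ipoly s p)"
      using s p0 by (simp add: f_def g_def ipoly_reverse_digits cnjp ipoly_cnj right_diff_distrib)
    also have "norm \<dots> = norm y"
      using combination_conjugate[OF eq p(1)] p(2) 
      by (simp add: norm_mult norm_power y_def del: complex_cnj_diff)
    finally have y: "norm y \<le> B + of_int m * of_nat n" .
    have "(q ^ n - 1) * D \<le> of_nat a * D" using a by (intro mult_right_mono) (simp_all add: D_def)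
    also have "\<dots> = norm (of_nat a * (p * ipoly (t' - t) p - of_real \<theta>))" 
      by (simp add: norm_mult D_def)
    also have "of_nat a * (p * ipoly (t' - t) p - of_real \<theta>) = y - of_real (of_nat a * \<theta> - of_nat b)"
      by (simp add: y_def algebra_simps)
    also have "norm \<dots> \<le> norm y + \<bar>of_nat a * \<theta> - of_nat b\<bar>"
      by (metis norm_of_real norm_triangle_ineq4)
    finally show ?thesis using y b by linarith
  qed
  have "D \<le> 0"
  proof (rule LIMSEQ_le)
    define x where "x = inverse q"
    have x: "\<bar>x\<bar> < 1" "x > 0" using q_gt_1 by (auto simp: x_def inverse_less_1_iff)
    have xn: "(\<lambda>n. x ^ n) \<longlonglongrightarrow> 0" using x by (intro LIMSEQ_power_zero) auto
    show "(\<lambda>n. (1 - x ^ n) * D) \<longlonglongrightarrow> D"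
      using tendsto_mult[OF tendsto_diff[OF tendsto_const[of 1] xn] tendsto_const[of D]] by simp
    have "(\<lambda>n. of_nat n * x ^ n) \<longlonglongrightarrow> 0" using x by (intro powser_times_n_limit_0) auto
    from tendsto_add[OF tendsto_mult_right_zero[OF xn] tendsto_mult_right_zero[OF this]]
    show "(\<lambda>n. (1 + B) * x ^ n + of_int m * (of_nat n * x ^ n)) \<longlonglongrightarrow> 0" by simp
    have "(1 - x ^ n) * D \<le> (1 + B) * x ^ n + of_int m * (of_nat n * x ^ n)" for n
    proof -
      have "x ^ n * q ^ n = 1" using q_gt_1 by (simp add: x_def flip: power_mult_distrib)
      hence "(1 - x ^ n) * D = x ^ n * ((q ^ n - 1) * D)" by (simp add: algebra_simps)
      also have "\<dots> \<le> x ^ n * (1 + B + of_int m * of_nat n)"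
        using x bound[of n] by (intro mult_left_mono) auto
      finally show ?thesis by (simp add: algebra_simps)
    qed
    thus "\<exists>N. \<forall>n\<ge>N. (1 - x ^ n) * D \<le> (1 + B) * x ^ n + of_int m * (of_nat n * x ^ n)" by blast
  qed
  thus ?thesis by (simp add: D_def \<theta>_def)
qed

text \<open>
  The remainders of the expansion of \<open>1\<close> in base \<open>q\<close> all of whose digits are \<open>m\<close>. Since \<open>L\<close> is
  a repelling fixed point of \<open>x \<mapsto> q * x - m\<close> and \<open>1 < L\<close>, they decrease from \<open>1\<close>, with
  their distance to \<open>L\<close> growing by the factor \<open>q\<close>.
\<close>

primrec remainder :: "nat \<Rightarrow> int poly" where
  "remainder 0 = 1"
| "remainder (Suc l) = pCons 0 (remainder l) - [:m:]"

lemma remainder_eq_difference: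
  obtains t where "t \<in> digits m (Suc l)" "monom 1 l \<in> digits m (Suc l)" "remainder l = monom 1 l - t"
proof -
  have "\<exists>t\<in>digits m l. remainder l = monom 1 l - t"
  proof (induction l)
    case 0
    show ?case using m_pos by (intro bexI[of _ 0]) (auto simp: zero_in_digits one_poly_eq_simps monom_0)
  next
    case (Suc l)
    then obtain t where t: "t \<in> digits m l" "remainder l = monom 1 l - t" by blast
    have "monom 1 1 * t + [:m:] \<in> digits m (Suc 0 + l)"
      using digits_append[OF const_in_digits t(1), of m] m_pos by simp
    moreover have "monom 1 1 * t = pCons 0 t" by (simp add: monom_Suc monom_0)
    ultimately have "pCons 0 t + [:m:] \<in> digits m (Suc l)" by simp
    moreover have "remainder (Suc l) = monom 1 (Suc l) - (pCons 0 t + [:m:])"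
      using t(2) by (simp add: monom_Suc)
    ultimately show ?case by blast
  qed
  moreover have "monom 1 l \<in> digits m (Suc l)"
    using digits_top[OF zero_in_digits, of m 1 l] m_pos by simp
  ultimately show ?thesis using that digits_mono[of _ m l "Suc l"] by auto
qed

lemma val_remainder: "val (remainder l) = L - (L - 1) * q ^ l"
proof (induction l)
  case (Suc l)
  have "val (remainder (Suc l)) = q * (L - (L - 1) * q ^ l) - of_int m" by (simp add: Suc.IH)
  also have "\<dots> = L - (L - 1) * q ^ Suc l" using L_mult_q by (simp add: right_diff_distrib mult_ac)
  finally show ?case .
qed simp

text \<open>
  The quotient of \<open>z * r(z) - q * r(q)\<close> by \<open>z - q\<close> has the remainders as coefficients (Horner's
  scheme).
\<close>

lemma remainder_difference:
  fixes z :: complex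
  shows "z * ipoly (remainder l) z - of_real (q * val (remainder l)) =
    (z - of_real q) * (\<Sum>i\<le>l. of_real (val (remainder i)) * z ^ (l - i))"
proof (induction l)
  case 0
  show ?case by (simp add: one_pCons)
next
  case (Suc l)
  have "(\<Sum>i\<le>Suc l. of_real (val (remainder i)) * z ^ (Suc l - i)) =
     z * (\<Sum>i\<le>l. of_real (val (remainder i)) * z ^ (l - i)) + of_real (val (remainder (Suc l)))"
    by (simp add: sum_distrib_left Suc_diff_le mult_ac del: remainder.simps(2))
  hence "(z - of_real q) * (\<Sum>i\<le>Suc l. of_real (val (remainder i)) * z ^ (Suc l - i)) =
     z * (z * ipoly (remainder l) z - of_real (q * val (remainder l)))
      + (z - of_real q) * of_real (val (remainder (Suc l)))"
    unfolding Suc.IH by (simp add: algebra_simps del: remainder.simps(2))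
  thus ?case by (simp add: algebra_simps)
qed

text \<open>
  Let \<open>d\<close> be the first remainder for which the walk is possible, that is, the first one below
  \<open>L - 1/q\<close>. It is positive: either it is \<open>1\<close>, or its predecessor \<open>x\<close> is at least \<open>L - 1/q\<close>, and
  then \<open>q * x - m \<ge> L - 1\<close>. If \<open>norm p \<ge> 1\<close>, then
  \<open>p\<close> is a root of \<open>z * r(z) - q * r(q)\<close>, hence of a polynomial with the decreasing coefficients
  \<open>1 > \<dots> > d > 0\<close>, which has no root of modulus at least \<open>1\<close>.
\<close>

lemma norm_conjugate_less_1:
  fixes p :: complex
  assumes p: "conjugate_to q p" "p \<noteq> of_real q"
    and recip: "norm p = 1 \<Longrightarrow> conjugate_to q (inverse q)"
  shows "norm p < 1"
proof (rule ccontr)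
  assume "\<not> norm p < 1"
  hence p1: "norm p \<ge> 1" by simp
  define l where "l = (LEAST l. 1 < (L - 1) * q ^ Suc l)"
  have "\<exists>l. 1 < (L - 1) * q ^ Suc l"
  proof -
    have "\<exists>k\<ge>1. 1 < q ^ k * (L - 1)" by (rule exists_power_gt) (use L_gt_1 in simp)
    then obtain k where "k \<ge> 1" "1 < q ^ k * (L - 1)" by blast
    thus ?thesis by (intro exI[of _ "k - 1"]) (simp add: mult.commute)
  qed
  hence l: "1 < (L - 1) * q ^ Suc l" unfolding l_def by (rule LeastI_ex)
  have least: "(L - 1) * q ^ i \<le> 1" if i: "0 < i" "i \<le> l" for i
  proof -
    obtain i' where i': "i = Suc i'" using i(1) by (cases i) auto
    thus ?thesis using not_less_Least[of i' "\<lambda>l. 1 < (L - 1) * q ^ Suc l"] i(2)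
      unfolding l_def[symmetric] by (simp add: not_less)
  qed
  define r where "r = (\<lambda>i. if i \<le> l then val (remainder i) else 0)"
  have r0: "r 0 = 1" by (simp add: r_def one_pCons)
  have rpos: "0 < val (remainder i)" if "i \<le> l" for i
    using least[of i] that L_gt_1 by (cases "i = 0") (auto simp: val_remainder)
  have dec: "r (Suc i) \<le> r i" "r (Suc 0) < r 0" for i
  proof -
    have step: "val (remainder (Suc i)) < val (remainder i)" for i
      using L_gt_1 q_gt_1 by (simp add: val_remainder del: remainder.simps)
    thus "r (Suc i) \<le> r i" using rpos[of i] by (auto simp: r_def less_imp_le simp del: remainder.simps)
    show "r (Suc 0) < r 0" using step[of 0] rpos[of 0] by (auto simp: r_def simp del: remainder.simps)
  qed
  define d where "d = val (remainder l)"
  have d: "0 < d" "d + 1 / q < L"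
    using rpos[of l] l q_gt_1 by (simp_all add: d_def val_remainder field_simps)
  obtain t where t: "t \<in> digits m (Suc l)" "monom 1 l \<in> digits m (Suc l)" "remainder l = monom 1 l - t"
    by (rule remainder_eq_difference)
  have dt: "d = val (monom 1 l) - val t" unfolding d_def t(3) by (rule ipoly_diff)
  have "p * ipoly (remainder l) p = of_real (q * d)"
  proof (cases "norm p = 1")
    case True
    show ?thesis unfolding t(3)
      by (rule conjugate_on_unit_circle[OF t(1,2) dt d p(1) True recip[OF True]])
  next
    case False
    hence "norm p > 1" using p1 by simp
    show ?thesis unfolding t(3)
      by (rule conjugate_outside[OF t(1,2) dt d p(1) \<open>norm p > 1\<close>])
  qed
  hence "(p - of_real q) * (\<Sum>i\<le>l. of_real (val (remainder i)) * p ^ (l - i)) = 0"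
    using remainder_difference[of p l] by (simp add: d_def)
  hence "(\<Sum>i\<le>l. of_real (val (remainder i)) * p ^ (l - i)) = 0" using p(2) by simp
  moreover have "(\<Sum>i\<le>l. of_real (r i) * p ^ (l - i)) \<noteq> 0"
    by (rule enestroem_kakeya) (use dec rpos p1 in \<open>auto simp: r_def less_imp_le\<close>)
  moreover have "(\<Sum>i\<le>l. of_real (r i) * p ^ (l - i)) = (\<Sum>i\<le>l. of_real (val (remainder i)) * p ^ (l - i))"
    by (rule sum.cong) (auto simp: r_def)
  ultimately show False by simp
qed

end

section \<open>Minimal polynomials\<close>

definition rpoly :: "rat poly \<Rightarrow> 'a :: field_char_0 \<Rightarrow> 'a" where
  "rpoly f x = poly (map_poly of_rat f) x"

lemma rpoly_0 [simp]: "rpoly 0 x = 0"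
  by (simp add: rpoly_def)

lemma rpoly_pCons [simp]: "rpoly (pCons a f) x = of_rat a + x * rpoly f x"
  by (simp add: rpoly_def map_poly_pCons)

lemma rpoly_add [simp]: "rpoly (f + g) x = rpoly f x + rpoly g x"
proof -
  have "map_poly of_rat (f + g) = (map_poly of_rat f + map_poly of_rat g :: 'a poly)"
    by (intro poly_eqI) (simp add: coeff_map_poly of_rat_add)
  thus ?thesis by (simp add: rpoly_def)
qed

lemma rpoly_smult [simp]: "rpoly (smult a f) x = of_rat a * rpoly f x"
proof -
  have "map_poly of_rat (smult a f) = smult (of_rat a) (map_poly of_rat f :: 'a poly)"
    by (intro poly_eqI) (simp add: coeff_map_poly of_rat_mult)
  thus ?thesis by (simp add: rpoly_def)
qed

lemma rpoly_mult [simp]: "rpoly (f * g) x = rpoly f x * rpoly g x"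
  by (induction f) (simp_all add: algebra_simps)

lemma rpoly_cnj: "rpoly f (cnj z) = cnj (rpoly f z)"
proof (induction f)
  case (pCons a f)
  have "cnj (of_rat a) = of_rat a" by (cases a) (simp add: of_rat_rat)
  thus ?case using pCons by simp
qed simp

lemma rpoly_of_int: "rpoly (map_poly of_int f) x = ipoly f x"
  by (induction f) (simp_all add: map_poly_pCons)

lemma rpoly_reflect:
  assumes "x \<noteq> 0"
  shows "rpoly (reflect_poly f) x = x ^ degree f * rpoly f (inverse x)"
proof -
  have "map_poly of_rat (reflect_poly f) = (reflect_poly (map_poly of_rat f) :: 'a poly)"
    by (intro poly_eqI) (simp add: coeff_map_poly coeff_reflect_poly degree_map_poly)
  moreover have "degree (map_poly of_rat f :: 'a poly) = degree f" by (simp add: degree_map_poly)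
  ultimately show ?thesis
    using assms by (simp add: rpoly_def poly_reflect_poly_nz)
qed

lemma is_min_poly_iff:
  "is_min_poly x p \<longleftrightarrow> lead_coeff p = 1 \<and> rpoly p x = 0 \<and>
     (\<forall>u. u \<noteq> 0 \<and> rpoly u x = 0 \<longrightarrow> degree p \<le> degree u)"
  by (simp add: is_min_poly_def rpoly_def)

lemma is_min_poly_exists:
  assumes "u \<noteq> 0" "rpoly u x = 0"
  shows "\<exists>p. is_min_poly x p"
proof -
  obtain p where p: "p \<noteq> 0" "rpoly p x = 0" "\<And>v. v \<noteq> 0 \<Longrightarrow> rpoly v x = 0 \<Longrightarrow> degree p \<le> degree v"
    using ex_has_least_nat[of "\<lambda>u. u \<noteq> 0 \<and> rpoly u x = 0" u degree] assms by blast
  define p' where "p' = smult (inverse (lead_coeff p)) p"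
  have "lead_coeff p' = 1" "rpoly p' x = 0" "degree p' = degree p"
    using p by (simp_all add: p'_def)
  thus ?thesis unfolding is_min_poly_iff using p(3) by metis
qed

lemma is_min_poly_dvd:
  assumes "is_min_poly x p" "rpoly u x = 0"
  shows "p dvd u"
proof (rule ccontr)
  assume "\<not> p dvd u"
  hence nz: "u mod p \<noteq> 0" by (simp add: dvd_eq_mod_eq_0)
  have p0: "p \<noteq> 0" using assms(1) by (auto simp: is_min_poly_iff)
  have "rpoly u x = rpoly (u div p * p + u mod p) x" by simp
  hence "rpoly (u mod p) x = 0" using assms unfolding is_min_poly_iff rpoly_add rpoly_mult by simp
  hence "degree p \<le> degree (u mod p)" using assms(1) nz unfolding is_min_poly_iff by blast
  moreover have "degree (u mod p) < degree p" using degree_mod_less[OF p0, of u] nz by blast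
  ultimately show False by simp
qed

text \<open>
  Otherwise the minimal polynomial of \<open>z\<close> would be a proper factor of \<open>p\<close>, and either it or its
  cofactor would vanish at \<open>x\<close>.
\<close>

lemma is_min_poly_root:
  assumes "is_min_poly x p" "rpoly p z = 0"
  shows "is_min_poly z p"
proof -
  have p: "p \<noteq> 0" "lead_coeff p = 1" using assms(1) by (auto simp: is_min_poly_iff)
  obtain g where g: "is_min_poly z g" using is_min_poly_exists[OF p(1) assms(2)] by blast
  obtain h where h: "p = g * h" using is_min_poly_dvd[OF g assms(2)] by (rule dvdE)
  have nz: "g \<noteq> 0" "h \<noteq> 0" using h p by auto
  have deg: "degree p = degree g + degree h" unfolding h using nz by (rule degree_mult_eq)
  have "degree g \<noteq> 0"
  proof
    assume "degree g = 0"
    then obtain a where "g = [:a:]" by (rule degree_eq_zeroE)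
    thus False using g by (auto simp: is_min_poly_iff)
  qed
  moreover have "rpoly g x = 0 \<or> rpoly h x = 0" using assms(1) h by (simp add: is_min_poly_iff)
  hence "degree p \<le> degree g \<or> degree p \<le> degree h" using assms(1) nz unfolding is_min_poly_iff by blast
  ultimately have "degree p = degree g" using deg by linarith
  thus ?thesis using g assms(2) p by (simp add: is_min_poly_iff)
qed

lemma conjugate_to_min_poly_root:
  assumes "is_min_poly q f" "rpoly f z = 0"
  shows "conjugate_to q z"
  unfolding conjugate_to_def
proof (intro allI impI)
  fix h assume "ipoly h q = 0"
  hence "rpoly (map_poly of_int h) q = 0" by (simp add: rpoly_of_int)
  hence "f dvd map_poly of_int h" by (rule is_min_poly_dvd[OF assms(1)])
  then obtain g where "map_poly of_int h = f * g" by (rule dvdE)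
  hence "rpoly (map_poly of_int h) z = 0" using assms(2) by simp
  thus "ipoly h z = 0" by (simp add: rpoly_of_int)
qed

text \<open>
  The root \<open>z\<close> is shared with its conjugate \<open>1/z\<close> and hence with the reflected polynomial, which
  by minimality is a multiple of \<open>f\<close>.
\<close>

lemma min_poly_reciprocal_root:
  fixes z :: complex
  assumes "is_min_poly q f" "rpoly f z = 0" "norm z = 1" "q \<noteq> 0"
  shows "rpoly f (inverse q) = 0"
proof -
  have z0: "z \<noteq> 0" using assms(3) by auto
  have "inverse z = cnj z"
    using assms(3) by (intro inverse_unique) (simp flip: complex_norm_square)
  hence "rpoly (reflect_poly f) z = 0" using assms(2) z0 by (simp add: rpoly_reflect rpoly_cnj)
  hence "f dvd reflect_poly f" by (rule is_min_poly_dvd[OF is_min_poly_root[OF assms(1,2)]])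
  then obtain g where "reflect_poly f = f * g" by (rule dvdE)
  hence "rpoly (reflect_poly f) q = 0" using assms(1) by (simp add: is_min_poly_iff)
  thus ?thesis using assms(4) by (simp add: rpoly_reflect)
qed

section \<open>Uniformly discrete sets with inflation\<close>

text \<open>
  The inclusion, iterated by Horner's scheme from any point of \<open>\<Lambda>\<close>, puts a translated copy of
  the values of digit strings on a line inside \<open>\<Lambda>\<close>. So \<open>\<Lambda>\<close> passes its separation on to them.
\<close>

lemma digit_orbit:
  fixes \<theta> :: real and f :: "'a :: real_vector"
  assumes incl: "(\<lambda>x. \<theta> *\<^sub>R x) ` \<Lambda> + (\<lambda>k. real_of_int k *\<^sub>R f) ` {0..m} \<subseteq> \<Lambda>"
    and "y \<in> \<Lambda>" "g \<in> digits m k"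
  shows "\<theta> ^ k *\<^sub>R y + ipoly g \<theta> *\<^sub>R f \<in> \<Lambda>"
  using assms(3)
proof (induction k arbitrary: g)
  case 0
  hence "g = 0" using digits_0 by blast
  thus ?case using assms(2) by simp
next
  case (Suc k)
  hence "g \<in> digits m (Suc 0 + k)" by simp
  then obtain x t where xt: "x \<in> digits m (Suc 0)" "t \<in> digits m k" "g = monom 1 (Suc 0) * t + x"
    by (rule digits_split)
  have x: "x = [:coeff x 0:]"
    using xt(1) by (intro poly_eqI) (auto simp: digits_def coeff_pCons split: nat.splits)
  have "coeff x 0 \<in> {0..m}" using xt(1) unfolding digits_def by blast
  define w where "w = \<theta> ^ k *\<^sub>R y + ipoly t \<theta> *\<^sub>R f"
  have "w \<in> \<Lambda>" unfolding w_def by (rule Suc.IH[OF xt(2)])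
  hence "\<theta> *\<^sub>R w + real_of_int (coeff x 0) *\<^sub>R f \<in> \<Lambda>"
    using \<open>coeff x 0 \<in> {0..m}\<close> by (blast intro: subsetD[OF incl set_plus_intro])
  moreover have "ipoly g \<theta> = \<theta> * ipoly t \<theta> + of_int (coeff x 0)"
    unfolding xt(3) by (subst x) simp
  ultimately show ?case by (simp add: w_def scaleR_add_right scaleR_add_left add.assoc)
qed

theorem theorem2:
  fixes \<theta> :: real and m :: int and f :: "real ^ 'n" and \<Lambda> :: "(real ^ 'n) set"
  assumes "\<theta> > 1"
    and "real_of_int m > \<theta> - 1"
    and "f \<noteq> 0"
    and "\<Lambda> \<noteq> {}"
    and "uniform_discrete \<Lambda>"
    and "(\<lambda>x. \<theta> *\<^sub>R x) ` \<Lambda> + (\<lambda>k. real_of_int k *\<^sub>R f) ` {0..m} \<subseteq> \<Lambda>"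
  shows "pisot \<theta>"
proof -
  obtain y where y: "y \<in> \<Lambda>" using assms(4) by blast
  obtain e where e: "e > 0" "\<And>x y. x \<in> \<Lambda> \<Longrightarrow> y \<in> \<Lambda> \<Longrightarrow> dist x y < e \<Longrightarrow> x = y"
    using assms(5) unfolding uniform_discrete_def by blast
  interpret separated_digits \<theta> "e / norm f" m
  proof
    fix k g h assume gh: "g \<in> digits m k" "h \<in> digits m k" "ipoly g \<theta> \<noteq> ipoly h \<theta>"
    let ?G = "\<theta> ^ k *\<^sub>R y + ipoly g \<theta> *\<^sub>R f" and ?H = "\<theta> ^ k *\<^sub>R y + ipoly h \<theta> *\<^sub>R f"
    have "?G \<in> \<Lambda>" "?H \<in> \<Lambda>" using gh by (intro digit_orbit[OF assms(6) y]; simp)+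
    moreover have "?G \<noteq> ?H" using gh(3) assms(3) by simp
    ultimately have "e \<le> dist ?G ?H" using e(2) not_less by blast
    also have "dist ?G ?H = \<bar>ipoly g \<theta> - ipoly h \<theta>\<bar> * norm f"
      by (simp add: dist_norm flip: scaleR_diff_left)
    finally show "e / norm f \<le> \<bar>ipoly g \<theta> - ipoly h \<theta>\<bar>"
      using assms(3) by (simp add: field_simps)
  qed (use assms e(1) in simp_all)
  obtain n c where "synchronizing n c" using exists_synchronizing by blast
  then interpret synchronized_digits \<theta> "e / norm f" m n c by unfold_locales
  have alg: "algebraic_int \<theta>" by (rule algebraic_int_base)
  then obtain h :: "int poly" where h: "ipoly h \<theta> = 0" "lead_coeff h = 1"
    unfolding algebraic_int_altdef_ipoly ipoly_def by blast
  have "map_poly rat_of_int h \<noteq> 0" using h(2) by (subst map_poly_eq_0_iff) auto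
  moreover have "rpoly (map_poly of_int h) \<theta> = 0" using h(1) by (simp add: rpoly_of_int)
  ultimately obtain p where p: "is_min_poly \<theta> p" using is_min_poly_exists by blast
  have "cmod z < 1" if "poly (map_poly of_rat p) z = 0" "z \<noteq> complex_of_real \<theta>" for z :: complex
  proof (rule norm_conjugate_less_1)
    have z: "rpoly p z = 0" using that(1) by (simp add: rpoly_def)
    show "conjugate_to \<theta> z" by (rule conjugate_to_min_poly_root[OF p z])
    show "conjugate_to \<theta> (inverse \<theta>)" if "norm z = 1"
      using min_poly_reciprocal_root[OF p z that] q_nonzero by (intro conjugate_to_min_poly_root[OF p])
  qed fact
  thus ?thesis unfolding pisot_def using assms(1) alg p by blast
qed

end
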